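(* Suppose that $\tau,\sigma,\sigma/\tau,\tau+\sigma\in\mathbb{C}-\mathbb{R}$. Let \[ Q(z;\tau,\sigma)=\frac{z^3}{3\tau\sigma}-\frac{\tau+\sigma-1}{2\tau\sigma}z^2+\frac{\tau^2+\sigma^2+3\tau\sigma-3\tau-3\sigma+1}{6\tau\sigma}z+\frac1{12}(\tau+\sigma-1)(\tau^{-1}+\sigma^{-1}-1). \] Then the following identities of meromorphic functions of $z$ hold: \[ \Gamma(z,\tau+1,\sigma)=\Gamma(z,\tau,\sigma+1)=\Gamma(z,\tau,\sigma), \] \[ \Gamma(z,\tau+\sigma,\sigma)=\frac{\Gamma(z,\tau,\sigma)}{\Gamma(z+\tau,\tau,\sigma+\tau)}, \] \[ \Gamma(z/\sigma,\tau/\sigma,-1/\sigma)=e^{i\pi Q(z;\tau,\sigma)}\,\Gamma((z-\sigma)/\tau,-1/\tau,-\sigma/\tau)\,\Gamma(z,\tau,\sigma), \] \[ \Gamma(z/\tau,-1/\tau,\sigma/\tau)=e^{i\pi Q(z;\tau,\sigma)}\,\Gamma((z-\tau)/\sigma,-\tau/\sigma,-1/\sigma)\,\Gamma(z,\tau,\sigma). \]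
   Context: For $|q|<1$, $|r|<1$ put $(x;q,r)=\prod_{j,k=0}^\infty(1-xq^jr^k)$. This is extended to a meromorphic function on $\{(x,q,r): |q|\neq1\neq|r|\}$ by requiring \[ (x;q^{-1},r)=\frac1{(qx;q,r)},\qquad (x;q,r^{-1})=\frac1{(rx;q,r)}. \] For $\tau,\sigma\in\mathbb{C}-\mathbb{R}$ the elliptic gamma function is \[ \Gamma(z,\tau,\sigma)=\frac{(qr/x;q,r)}{(x;q,r)},\qquad x=e^{2\pi iz},\ q=e^{2\pi i\tau},\ r=e^{2\pi i\sigma}. \] Equivalently, $\Gamma$ is given by this infinite product quotient for $\mathrm{Im}\,\tau,\mathrm{Im}\,\sigma>0$ and extended by $\Gamma(z,-\tau,\sigma)=1/\Gamma(z+\tau,\tau,\sigma)$, $\Gamma(z,\tau,-\sigma)=1/\Gamma(z+\sigma,\tau,\sigma)$. *)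

theory Defs
  imports "HOL-Complex_Analysis.Complex_Analysis"
begin

text \<open>
  The double product is written as an iterated infinite product; it converges absolutely
  when the moduli of \<open>q\<close> and \<open>r\<close> are less than one, so the order of the factors is irrelevant.
\<close>

definition double_prod :: "complex \<Rightarrow> complex \<Rightarrow> complex \<Rightarrow> complex" where
  "double_prod x q r = (\<Prod>j. \<Prod>k. 1 - x * q ^ j * r ^ k)"

text \<open>
  The extension to moduli different from one. The last three cases are the relations
  \<open>(x; 1/q, r) = 1 / (q x; q, r)\<close> and \<open>(x; q, 1/r) = 1 / (r x; q, r)\<close> solved for the
  symbol whose parameters have modulus greater than one; the lemmas below show
  that the relations then hold throughout. On the excluded set where \<open>q\<close> or \<open>r\<close> has modulus one,
  the value is an arbitrary dummy.
\<close>

definition qr_symbol :: "complex \<Rightarrow> complex \<Rightarrow> complex \<Rightarrow> complex" where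
  "qr_symbol x q r =
     (if norm q < 1 \<and> norm r < 1 then double_prod x q r
      else if norm q > 1 \<and> norm r < 1 then 1 / double_prod (x / q) (1 / q) r
      else if norm q < 1 \<and> norm r > 1 then 1 / double_prod (x / r) q (1 / r)
      else if norm q > 1 \<and> norm r > 1 then double_prod (x / (q * r)) (1 / q) (1 / r)
      else 0)"

lemma qr_symbol_inverse_left:
  assumes "q \<noteq> 0" "norm q \<noteq> 1" "norm r \<noteq> 1"
  shows "qr_symbol x (1 / q) r = 1 / qr_symbol (q * x) q r"
proof -
  have "norm (1 / q) < 1 \<longleftrightarrow> norm q > 1" "norm (1 / q) > 1 \<longleftrightarrow> norm q < 1"
    using assms by (auto simp: norm_divide divide_simps)
  thus ?thesis
    using assms by (auto simp: qr_symbol_def mult_ac)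
qed

lemma qr_symbol_inverse_right:
  assumes "r \<noteq> 0" "norm q \<noteq> 1" "norm r \<noteq> 1"
  shows "qr_symbol x q (1 / r) = 1 / qr_symbol (r * x) q r"
proof -
  have "norm (1 / r) < 1 \<longleftrightarrow> norm r > 1" "norm (1 / r) > 1 \<longleftrightarrow> norm r < 1"
    using assms by (auto simp: norm_divide divide_simps)
  thus ?thesis
    using assms by (auto simp: qr_symbol_def mult_ac)
qed

definition elliptic_gamma :: "complex \<Rightarrow> complex \<Rightarrow> complex \<Rightarrow> complex" where
  "elliptic_gamma z \<tau> \<sigma> =
     (let x = exp (2 * of_real pi * \<i> * z);
          q = exp (2 * of_real pi * \<i> * \<tau>);
          r = exp (2 * of_real pi * \<i> * \<sigma>)
      in qr_symbol (q * r / x) q r / qr_symbol x q r)"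

definition Q_poly :: "complex \<Rightarrow> complex \<Rightarrow> complex \<Rightarrow> complex" where
  "Q_poly z \<tau> \<sigma> =
     z ^ 3 / (3 * \<tau> * \<sigma>)
     - (\<tau> + \<sigma> - 1) / (2 * \<tau> * \<sigma>) * z ^ 2
     + (\<tau> ^ 2 + \<sigma> ^ 2 + 3 * \<tau> * \<sigma> - 3 * \<tau> - 3 * \<sigma> + 1) / (6 * \<tau> * \<sigma>) * z
     + 1 / 12 * (\<tau> + \<sigma> - 1) * (1 / \<tau> + 1 / \<sigma> - 1)"

text \<open>
  Equality of two meromorphic functions on the complex plane. Functions are total here, and
  division by zero gives zero, so the values at poles (and at removable singularities created by
  taking quotients) carry no meaning. Two meromorphic functions are therefore the same when their
  values agree outside a set without accumulation points.
\<close>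

definition meromorphic_eq :: "(complex \<Rightarrow> complex) \<Rightarrow> (complex \<Rightarrow> complex) \<Rightarrow> bool" where
  "meromorphic_eq f g \<longleftrightarrow>
     f meromorphic_on UNIV \<and> g meromorphic_on UNIV \<and> (\<forall>\<^sub>\<approx>z\<in>UNIV. f z = g z)"

end

theory Submission
  imports Defs
begin

text \<open>
  Off the countable group \<open>\<int> + \<int>\<tau> + \<int>\<sigma>\<close> all gamma functions in question have nonzero finite
  values. Each identity is first proved pointwise there; because a meromorphic function that does
  not vanish identically near a point is nonzero on a punctured disc around it, this implies
  equality of meromorphic functions (\<open>meromorphic_eq_if_eq_off_countable\<close>).

  Invariance under \<open>\<tau> \<mapsto> \<tau> + 1\<close> and \<open>\<sigma> \<mapsto> \<sigma> + 1\<close> is immediate. The identity with the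
  parameter \<open>\<tau> + \<sigma>\<close> is the splitting of a quadrant of exponents into two cones, that is,
  \<open>(x; q, r) = (q x; q, q r) (x; q r, r)\<close> (\<open>double_prod_split\<close>), for every sign pattern of the
  imaginary parts. Identities between such products follow from one uniqueness
  principle: a function that is continuous at \<open>0\<close> with value \<open>1\<close> is determined by its dilation
  equation \<open>F x = a x * F (p x)\<close> with \<open>norm p < 1\<close>.

  For the modular relation, let \<open>f\<close> be the quotient of its two sides. Translation of \<open>z\<close> by \<open>\<tau>\<close> or
  \<open>\<sigma>\<close> multiplies a gamma function by a theta function (\<open>elliptic_gamma_add_modulus\<close>), and the theta
  functions that arise from translating \<open>f\<close> by \<open>1\<close>, \<open>\<tau>\<close> or \<open>\<sigma>\<close> are related by the inversion formula
  \<open>theta_modular\<close>, whose constant is known to be a cube root of unity. The differences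
  of the cubic polynomial \<^const>\<open>Q_poly\<close> match the exponents in that formula, so \<open>f ^ 3\<close> has the three
  periods \<open>1\<close>, \<open>\<tau>\<close>, \<open>\<sigma>\<close>. If these are rationally independent, there are arbitrarily small
  periods, so \<open>f ^ 3\<close> and then \<open>f\<close> is constant (\<open>modular_quotient_generic\<close>). Its
  value is found at \<open>(\<tau> + \<sigma> - 1) / 2\<close>, where the polynomial vanishes and the reflection symmetry
  makes all three gamma functions equal to one. The general case follows by continuity in \<open>\<sigma>\<close>, because
  dependent parameters form a countable set. The second modular relation is the first
  with \<open>\<tau>\<close> and \<open>\<sigma>\<close> interchanged.
\<close>

section \<open>Infinite products depending on parameters\<close>

text \<open>
  The Weierstrass M-test for products: with a summable bound on the distance of the factors
  from one, an infinite product of continuous functions converges uniformly and is continuous.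
\<close>

lemma prodinf_M_test:
  fixes f :: "nat \<Rightarrow> 'a::topological_space \<Rightarrow> complex" and M :: "nat \<Rightarrow> real"
  assumes cont: "\<And>n. continuous_on A (f n)" and A: "compact A"
    and M: "summable M" and bound: "\<And>n x. x \<in> A \<Longrightarrow> norm (f n x - 1) \<le> M n"
  shows convergent_prod_M_test: "\<And>x. x \<in> A \<Longrightarrow> convergent_prod (\<lambda>n. f n x)"
    and uniform_limit_prodinf_M_test:
      "uniform_limit A (\<lambda>N x. \<Prod>n<N. f n x) (\<lambda>x. \<Prod>n. f n x) sequentially"
    and continuous_on_prodinf_M_test: "continuous_on A (\<lambda>x. \<Prod>n. f n x)"
proof -
  show conv: "convergent_prod (\<lambda>n. f n x)" if "x \<in> A" for x
  proof -
    have "summable (\<lambda>n. norm (f n x - 1))"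
      by (rule summable_comparison_test[OF _ M]) (use bound that in auto)
    thus ?thesis
      by (intro abs_convergent_prod_imp_convergent_prod summable_imp_abs_convergent_prod)
  qed
  have unif: "uniformly_convergent_on A (\<lambda>N x. \<Prod>n<N. f n x)"
  proof (rule uniformly_convergent_on_prod'[OF cont A])
    show "uniformly_convergent_on A (\<lambda>N x. \<Sum>n<N. norm (f n x - 1))"
      by (rule Weierstrass_m_test'[OF _ M]) (use bound in auto)
  qed
  show lim: "uniform_limit A (\<lambda>N x. \<Prod>n<N. f n x) (\<lambda>x. \<Prod>n. f n x) sequentially"
  proof -
    from unif obtain l where l: "uniform_limit A (\<lambda>N x. \<Prod>n<N. f n x) l sequentially"
      by (auto simp: uniformly_convergent_on_def)
    have "l x = (\<Prod>n. f n x)" if x: "x \<in> A" for x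
    proof (rule LIMSEQ_unique)
      show "(\<lambda>N. \<Prod>n<N. f n x) \<longlonglongrightarrow> l x"
        by (rule tendsto_uniform_limitI[OF l x])
      have "(\<lambda>N. \<Prod>n<Suc N. f n x) \<longlonglongrightarrow> (\<Prod>n. f n x)"
        using convergent_prod_LIMSEQ[OF conv[OF x]] by (simp add: lessThan_Suc_atMost)
      thus "(\<lambda>N. \<Prod>n<N. f n x) \<longlonglongrightarrow> (\<Prod>n. f n x)"
        by (rule LIMSEQ_offset[where k = 1, simplified])
    qed
    thus ?thesis
      using l by (subst uniform_limit_cong'[of A _ _ _ l]) auto
  qed
  show "continuous_on A (\<lambda>x. \<Prod>n. f n x)"
    by (rule uniform_limit_theorem[OF _ lim]) (auto intro!: always_eventually continuous_intros cont)
qed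

lemma prodinf_LIMSEQ_lessThan:
  fixes f :: "nat \<Rightarrow> complex"
  assumes "convergent_prod f"
  shows "(\<lambda>N. \<Prod>n<N. f n) \<longlonglongrightarrow> prodinf f"
proof -
  have "(\<lambda>N. \<Prod>n<Suc N. f n) \<longlonglongrightarrow> prodinf f"
    using convergent_prod_LIMSEQ[OF assms] by (simp add: lessThan_Suc_atMost)
  thus ?thesis
    by (rule LIMSEQ_offset[where k = 1, simplified])
qed

text \<open>
  No factor has to be nonzero here, so the functional equations below hold at zeros as well.
\<close>

lemma prodinf_head:
  fixes f :: "nat \<Rightarrow> complex"
  assumes "convergent_prod f"
  shows "prodinf f = f 0 * (\<Prod>n. f (Suc n))"
proof (rule LIMSEQ_unique)
  show "(\<lambda>N. \<Prod>n<Suc N. f n) \<longlonglongrightarrow> prodinf f"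
    using prodinf_LIMSEQ_lessThan[OF assms] by (rule LIMSEQ_Suc)
  have "convergent_prod (\<lambda>n. f (Suc n))"
    using assms by simp
  from prodinf_LIMSEQ_lessThan[OF this]
  show "(\<lambda>N. \<Prod>n<Suc N. f n) \<longlonglongrightarrow> f 0 * (\<Prod>n. f (Suc n))"
    unfolding prod.lessThan_Suc_shift by (intro tendsto_intros)
qed

text \<open>
  The tool behind all product identities: iterating \<open>F x = a x * F (p * x)\<close> and the same equation
  for \<open>G\<close> expresses both functions at \<open>x\<close> by the same finite product and their values near zero,
  where both tend to one.
\<close>

lemma dilation_equation_unique:
  fixes F G a :: "complex \<Rightarrow> complex"
  assumes p: "norm p < 1"
    and F: "isCont F 0" "F 0 = 1" "\<And>x. F x = a x * F (p * x)"
    and G: "isCont G 0" "G 0 = 1" "\<And>x. G x = a x * G (p * x)"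
  shows "F x = G x"
proof -
  have eq: "F x * G (p ^ n * x) = G x * F (p ^ n * x)" for n
  proof -
    have "F x = (\<Prod>i<n. a (p ^ i * x)) * F (p ^ n * x)"
    proof (induction n)
      case (Suc n)
      thus ?case using F(3)[of "p ^ n * x"] by (simp add: mult_ac)
    qed auto
    moreover have "G x = (\<Prod>i<n. a (p ^ i * x)) * G (p ^ n * x)"
    proof (induction n)
      case (Suc n)
      thus ?case using G(3)[of "p ^ n * x"] by (simp add: mult_ac)
    qed auto
    ultimately have "F x * G (p ^ n * x) = (\<Prod>i<n. a (p ^ i * x)) * F (p ^ n * x) * G (p ^ n * x)"
        "G x = (\<Prod>i<n. a (p ^ i * x)) * G (p ^ n * x)"
      by simp_all
    thus ?thesis by (simp add: mult_ac)
  qed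
  have lim0: "(\<lambda>n. p ^ n * x) \<longlonglongrightarrow> 0"
    using tendsto_mult[OF LIMSEQ_power_zero[OF p] tendsto_const[of x]] by simp
  have "(\<lambda>n. F x * G (p ^ n * x)) \<longlonglongrightarrow> F x * 1"
    using isCont_tendsto_compose[OF G(1) lim0] G(2) by (intro tendsto_intros) auto
  moreover have "(\<lambda>n. G x * F (p ^ n * x)) \<longlonglongrightarrow> G x * 1"
    using isCont_tendsto_compose[OF F(1) lim0] F(2) by (intro tendsto_intros) auto
  ultimately show ?thesis
    using LIMSEQ_unique unfolding eq by fastforce
qed

section \<open>Single and double q-products\<close>

text \<open>
  The \<open>q\<close>-Pochhammer symbol \<open>(x; q)\<close> with infinitely many factors, meaningful for \<open>norm q < 1\<close>.
\<close>

definition qpoch :: "complex \<Rightarrow> complex \<Rightarrow> complex" where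
  "qpoch x q = (\<Prod>k. 1 - x * q ^ k)"

lemma qpoch_factor_bound:
  fixes x q :: complex
  assumes "norm x \<le> R" "norm q \<le> \<rho>"
  shows "norm (1 - x * q ^ k - 1) \<le> R * \<rho> ^ k"
  using assms order_trans[OF norm_ge_zero assms(1)]
  by (auto simp: norm_mult norm_power intro!: mult_mono power_mono)

lemma convergent_prod_qpoch:
  fixes x q :: complex
  assumes "norm q < 1"
  shows "convergent_prod (\<lambda>k. 1 - x * q ^ k)"
  by (rule convergent_prod_M_test[where f = "\<lambda>k (x::complex). 1 - x * q ^ k" and x = x and A = "{x}"
        and M = "\<lambda>k. norm x * norm q ^ k"])
     (use assms qpoch_factor_bound in \<open>auto intro!: summable_mult summable_geometric\<close>)

lemma qpoch_0 [simp]: "qpoch 0 q = 1"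
  by (simp add: qpoch_def)

lemma qpoch_rec:
  assumes "norm q < 1"
  shows "qpoch x q = (1 - x) * qpoch (q * x) q"
  unfolding qpoch_def
  using prodinf_head[OF convergent_prod_qpoch[OF assms, of x]] by (simp add: mult_ac)

lemma qpoch_eq_0_iff:
  assumes "norm q < 1"
  shows "qpoch x q = 0 \<longleftrightarrow> (\<exists>k. x * q ^ k = 1)"
proof -
  have "(\<lambda>k. 1 - x * q ^ k) has_prod qpoch x q"
    unfolding qpoch_def using convergent_prod_qpoch[OF assms] by blast
  from has_prod_eq_0_iff[OF this] show ?thesis
    by (auto simp: image_iff)
qed

lemma continuous_on_qpoch:
  assumes "\<rho> < 1"
  shows "continuous_on (cball 0 R \<times> cball 0 \<rho>) (\<lambda>p. qpoch (fst p) (snd p))"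
proof (cases "\<rho> < 0")
  case False
  show ?thesis
    unfolding qpoch_def
  proof (rule continuous_on_prodinf_M_test[where M = "\<lambda>k. R * \<rho> ^ k"])
    show "norm (1 - fst p * snd p ^ k - 1) \<le> R * \<rho> ^ k" if "p \<in> cball 0 R \<times> cball 0 \<rho>"
      for p :: "complex \<times> complex" and k
      using that by (intro qpoch_factor_bound) auto
  qed (use assms False in \<open>auto intro!: continuous_intros compact_Times summable_mult summable_geometric\<close>)
qed auto

text \<open>
  The bound is linear in \<open>norm x\<close>, with a constant uniform in the parameters: this makes the outer
  product in \<^const>\<open>double_prod\<close> converge locally uniformly in all three variables.
\<close>

lemma norm_qpoch_minus_1_le:
  assumes x: "norm x \<le> R" and q: "norm q \<le> \<rho>" and \<rho>: "\<rho> < 1"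
  shows "norm (qpoch x q - 1) \<le> exp (R / (1 - \<rho>)) / (1 - \<rho>) * norm x"
proof -
  define t where "t = norm x / (1 - \<rho>)"
  have q1: "norm q < 1" using q \<rho> by simp
  have \<rho>0: "\<rho> \<ge> 0" using order_trans[OF norm_ge_zero q] .
  have "(\<lambda>N. norm ((\<Prod>k<N. 1 + - (x * q ^ k)) - 1)) \<longlonglongrightarrow> norm (qpoch x q - 1)"
    unfolding qpoch_def
    using prodinf_LIMSEQ_lessThan[OF convergent_prod_qpoch[OF q1, of x]]
    by (intro tendsto_intros) simp
  moreover have "norm ((\<Prod>k<N. 1 + - (x * q ^ k)) - 1) \<le> exp t - 1" for N
  proof -
    have "norm ((\<Prod>k<N. 1 + - (x * q ^ k)) - 1) \<le> (\<Prod>k<N. 1 + norm (- (x * q ^ k))) - 1"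
      by (rule norm_prod_minus1_le_prod_minus1)
    also have "(\<Prod>k<N. 1 + norm (- (x * q ^ k))) \<le> exp (\<Sum>k<N. norm (- (x * q ^ k)))"
      by (rule prod_le_exp_sum) auto
    also have "(\<Sum>k<N. norm (- (x * q ^ k))) \<le> (\<Sum>k<N. norm x * \<rho> ^ k)"
      by (intro sum_mono) (use q in \<open>auto simp: norm_mult norm_power intro!: mult_left_mono power_mono\<close>)
    also have "\<dots> \<le> (\<Sum>k. norm x * \<rho> ^ k)"
      by (rule sum_le_suminf) (use \<rho> \<rho>0 in \<open>auto intro!: summable_mult summable_geometric\<close>)
    also have "\<dots> = t"
      using \<rho> \<rho>0 by (simp add: suminf_mult summable_geometric suminf_geometric t_def)
    finally show ?thesis by simp
  qed
  ultimately have "norm (qpoch x q - 1) \<le> exp t - 1"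
    by (intro LIMSEQ_le_const2) auto
  \<comment> \<open>From \<open>1 - t \<le> exp (- t)\<close>, multiplied by \<open>exp t\<close>.\<close>
  also have "\<dots> \<le> t * exp t"
    using mult_right_mono[OF exp_ge_add_one_self[of "-t"], of "exp t"]
    by (simp add: algebra_simps flip: exp_add)
  also have "\<dots> \<le> t * exp (R / (1 - \<rho>))"
    unfolding t_def using x \<rho> by (intro mult_left_mono) (auto simp: divide_right_mono)
  finally show ?thesis by (simp add: t_def mult_ac)
qed

lemma tendsto_qpoch [tendsto_intros]:
  assumes f: "(f \<longlongrightarrow> x) F" and g: "(g \<longlongrightarrow> q) F" and q: "norm q < 1"
  shows "((\<lambda>t. qpoch (f t) (g t)) \<longlongrightarrow> qpoch x q) F"
proof -
  obtain \<rho> where \<rho>: "norm q < \<rho>" "\<rho> < 1"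
    using dense[OF q] by auto
  define B where "B = ball (0::complex) (norm x + 1) \<times> ball (0::complex) \<rho>"
  have "continuous_on B (\<lambda>p. qpoch (fst p) (snd p))"
    by (rule continuous_on_subset[OF continuous_on_qpoch[of \<rho> "norm x + 1"]])
       (use \<rho> in \<open>auto simp: B_def\<close>)
  moreover have "open B" "(x, q) \<in> B"
    using \<rho> by (auto simp: B_def open_Times)
  ultimately have "isCont (\<lambda>p. qpoch (fst p) (snd p)) (x, q)"
    by (simp add: continuous_on_eq_continuous_at)
  from isCont_tendsto_compose[OF this tendsto_Pair[OF f g]] show ?thesis by simp
qed

lemma isCont_qpoch:
  "isCont f z \<Longrightarrow> isCont g z \<Longrightarrow> norm (g z) < 1 \<Longrightarrow> isCont (\<lambda>z. qpoch (f z) (g z)) z"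
  unfolding isCont_def by (intro tendsto_intros)

lemma holomorphic_qpoch_UNIV:
  assumes q: "norm q < 1"
  shows "(\<lambda>x. qpoch x q) holomorphic_on UNIV"
proof (rule holomorphic_uniform_sequence)
  show "(\<lambda>x. \<Prod>k<N. 1 - x * q ^ k) holomorphic_on UNIV" for N
    by (intro holomorphic_intros)
  have "uniform_limit (cball x 1) (\<lambda>N x. \<Prod>k<N. 1 - x * q ^ k) (\<lambda>x. qpoch x q) sequentially" for x
    unfolding qpoch_def
  proof (rule uniform_limit_prodinf_M_test[where M = "\<lambda>k. (norm x + 1) * norm q ^ k"])
    show "norm (1 - y * q ^ k - 1) \<le> (norm x + 1) * norm q ^ k" if "y \<in> cball x 1" for y k
    proof (rule qpoch_factor_bound)
      show "norm y \<le> norm x + 1"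
        using that norm_triangle_sub[of y x] by (simp add: dist_norm norm_minus_commute)
    qed auto
  qed (use q in \<open>auto intro!: continuous_intros summable_mult summable_geometric\<close>)
  thus "\<exists>d>0. cball x d \<subseteq> UNIV \<and>
      uniform_limit (cball x d) (\<lambda>N x. \<Prod>k<N. 1 - x * q ^ k) (\<lambda>x. qpoch x q) sequentially" for x
    by (intro exI[of _ 1]) auto
qed auto

lemma holomorphic_qpoch [holomorphic_intros]:
  assumes "f holomorphic_on A" "norm q < 1"
  shows "(\<lambda>z. qpoch (f z) q) holomorphic_on A"
  using holomorphic_on_compose_gen[OF assms(1) holomorphic_qpoch_UNIV[OF assms(2)]]
  by (simp add: o_def)

lemma double_prod_eq_qpoch: "double_prod x q r = (\<Prod>j. qpoch (x * q ^ j) r)"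
  by (simp add: double_prod_def qpoch_def)

lemma double_prod_factor_bound:
  assumes x: "norm x \<le> R" and q: "norm q \<le> \<rho>" and r: "norm r \<le> \<rho>" and \<rho>: "\<rho> < 1"
  shows "norm (qpoch (x * q ^ j) r - 1) \<le> exp (R / (1 - \<rho>)) / (1 - \<rho>) * R * \<rho> ^ j"
proof -
  have \<rho>0: "\<rho> \<ge> 0" using order_trans[OF norm_ge_zero q] .
  have R0: "R \<ge> 0" using order_trans[OF norm_ge_zero x] .
  have le: "norm (x * q ^ j) \<le> R * \<rho> ^ j"
    using x q R0 by (auto simp: norm_mult norm_power intro!: mult_mono power_mono)
  also have "R * \<rho> ^ j \<le> R"
    using \<rho> \<rho>0 R0 by (simp add: mult_left_le power_le_one)
  finally have "norm (qpoch (x * q ^ j) r - 1) \<le> exp (R / (1 - \<rho>)) / (1 - \<rho>) * norm (x * q ^ j)"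
    by (rule norm_qpoch_minus_1_le[OF _ r \<rho>])
  also have "\<dots> \<le> exp (R / (1 - \<rho>)) / (1 - \<rho>) * (R * \<rho> ^ j)"
    using le \<rho> by (intro mult_left_mono) auto
  finally show ?thesis by (simp add: mult.assoc)
qed

lemma convergent_prod_double_prod:
  assumes q: "norm q < 1" and r: "norm r < 1"
  shows "convergent_prod (\<lambda>j. qpoch (x * q ^ j) r)"
proof -
  define \<rho> where "\<rho> = max (norm q) (norm r)"
  have \<rho>: "norm q \<le> \<rho>" "norm r \<le> \<rho>" "\<rho> < 1" "0 \<le> \<rho>"
    using q r by (auto simp: \<rho>_def le_max_iff_disj)
  show ?thesis
    by (rule convergent_prod_M_test[where f = "\<lambda>j (x::complex). qpoch (x * q ^ j) r" and x = x and A = "{x}"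
          and M = "\<lambda>j. exp (norm x / (1 - \<rho>)) / (1 - \<rho>) * norm x * \<rho> ^ j"])
       (use \<rho> double_prod_factor_bound in \<open>auto intro!: summable_mult summable_geometric\<close>)
qed

lemma double_prod_0 [simp]: "double_prod 0 q r = 1"
  by (simp add: double_prod_eq_qpoch)

lemma double_prod_rec:
  assumes "norm q < 1" "norm r < 1"
  shows "double_prod x q r = qpoch x r * double_prod (q * x) q r"
  unfolding double_prod_eq_qpoch
  using prodinf_head[OF convergent_prod_double_prod[OF assms, of x]] by (simp add: mult_ac)

lemma double_prod_eq_0_iff:
  assumes "norm q < 1" "norm r < 1"
  shows "double_prod x q r = 0 \<longleftrightarrow> (\<exists>j k. x * q ^ j * r ^ k = 1)"
proof -
  have "(\<lambda>j. qpoch (x * q ^ j) r) has_prod double_prod x q r"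
    unfolding double_prod_eq_qpoch using convergent_prod_double_prod[OF assms] by blast
  from has_prod_eq_0_iff[OF this] have "double_prod x q r = 0 \<longleftrightarrow> (\<exists>j. qpoch (x * q ^ j) r = 0)"
    by (auto simp: image_iff)
  thus ?thesis by (simp add: qpoch_eq_0_iff assms)
qed

lemma continuous_on_double_prod:
  assumes \<rho>: "\<rho> < 1"
  shows "continuous_on (cball 0 R \<times> cball 0 \<rho> \<times> cball 0 \<rho>)
           (\<lambda>p. double_prod (fst p) (fst (snd p)) (snd (snd p)))"
proof (cases "\<rho> < 0 \<or> R < 0")
  case False
  show ?thesis
    unfolding double_prod_eq_qpoch
  proof (rule continuous_on_prodinf_M_test[where
        M = "\<lambda>j. exp (R / (1 - \<rho>)) / (1 - \<rho>) * R * \<rho> ^ j"])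
    show "continuous_on (cball 0 R \<times> cball 0 \<rho> \<times> cball 0 \<rho>)
            (\<lambda>p. qpoch (fst p * fst (snd p) ^ j) (snd (snd p)))" for j
      unfolding continuous_on_def using \<rho> 
      by (intro ballI tendsto_intros) auto
    show "norm (qpoch (fst p * fst (snd p) ^ j) (snd (snd p)) - 1) \<le>
            exp (R / (1 - \<rho>)) / (1 - \<rho>) * R * \<rho> ^ j"
      if "p \<in> cball 0 R \<times> cball 0 \<rho> \<times> cball 0 \<rho>"
      for p :: "complex \<times> complex \<times> complex" and j
      using that \<rho> by (intro double_prod_factor_bound) auto
  qed (use \<rho> False in \<open>auto intro!: compact_Times summable_mult summable_geometric\<close>)
qed auto

lemma tendsto_double_prod [tendsto_intros]:
  assumes f: "(f \<longlongrightarrow> x) F" and g: "(g \<longlongrightarrow> q) F" and h: "(h \<longlongrightarrow> r) F"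
    and q: "norm q < 1" and r: "norm r < 1"
  shows "((\<lambda>t. double_prod (f t) (g t) (h t)) \<longlongrightarrow> double_prod x q r) F"
proof -
  obtain \<rho> where \<rho>: "max (norm q) (norm r) < \<rho>" "\<rho> < 1"
    using dense[of "max (norm q) (norm r)" 1] q r by auto
  define B where "B = ball (0::complex) (norm x + 1) \<times> ball (0::complex) \<rho> \<times> ball (0::complex) \<rho>"
  have "continuous_on B (\<lambda>p. double_prod (fst p) (fst (snd p)) (snd (snd p)))"
    by (rule continuous_on_subset[OF continuous_on_double_prod[of \<rho> "norm x + 1"]])
       (use \<rho> in \<open>auto simp: B_def\<close>)
  moreover have "open B" "(x, q, r) \<in> B"
    using \<rho> by (auto simp: B_def open_Times)
  ultimately have "isCont (\<lambda>p. double_prod (fst p) (fst (snd p)) (snd (snd p))) (x, q, r)"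
    by (simp add: continuous_on_eq_continuous_at)
  from isCont_tendsto_compose[OF this tendsto_Pair[OF f tendsto_Pair[OF g h]]] show ?thesis by simp
qed

lemma isCont_double_prod:
  "isCont f z \<Longrightarrow> isCont g z \<Longrightarrow> isCont h z \<Longrightarrow> norm (g z) < 1 \<Longrightarrow> norm (h z) < 1 \<Longrightarrow>
     isCont (\<lambda>z. double_prod (f z) (g z) (h z)) z"
  unfolding isCont_def by (intro tendsto_intros)

lemma holomorphic_double_prod_UNIV:
  assumes q: "norm q < 1" and r: "norm r < 1"
  shows "(\<lambda>x. double_prod x q r) holomorphic_on UNIV"
proof (rule holomorphic_uniform_sequence)
  define \<rho> where "\<rho> = max (norm q) (norm r)"
  have \<rho>: "norm q \<le> \<rho>" "norm r \<le> \<rho>" "\<rho> < 1" "0 \<le> \<rho>"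
    using q r by (auto simp: \<rho>_def le_max_iff_disj)
  show "(\<lambda>x. \<Prod>j<N. qpoch (x * q ^ j) r) holomorphic_on UNIV" for N
    by (intro holomorphic_intros r)
  have "uniform_limit (cball x 1) (\<lambda>N x. \<Prod>j<N. qpoch (x * q ^ j) r)
          (\<lambda>x. double_prod x q r) sequentially" for x
    unfolding double_prod_eq_qpoch
  proof (rule uniform_limit_prodinf_M_test[where
        M = "\<lambda>j. exp ((norm x + 1) / (1 - \<rho>)) / (1 - \<rho>) * (norm x + 1) * \<rho> ^ j"])
    show "norm (qpoch (y * q ^ j) r - 1) \<le> exp ((norm x + 1) / (1 - \<rho>)) / (1 - \<rho>) * (norm x + 1) * \<rho> ^ j"
      if "y \<in> cball x 1" for y j
    proof (rule double_prod_factor_bound)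
      show "norm y \<le> norm x + 1"
        using that norm_triangle_sub[of y x] by (simp add: dist_norm norm_minus_commute)
    qed (use \<rho> in auto)
    show "continuous_on (cball x 1) (\<lambda>y. qpoch (y * q ^ j) r)" for j
      by (intro holomorphic_on_imp_continuous_on holomorphic_intros r)
  qed (use \<rho> in \<open>auto intro!: summable_mult summable_geometric\<close>)
  thus "\<exists>d>0. cball x d \<subseteq> UNIV \<and>
      uniform_limit (cball x d) (\<lambda>N x. \<Prod>j<N. qpoch (x * q ^ j) r) (\<lambda>x. double_prod x q r) sequentially" for x
    by (intro exI[of _ 1]) auto
qed auto

lemma holomorphic_double_prod [holomorphic_intros]:
  assumes "f holomorphic_on A" "norm q < 1" "norm r < 1"
  shows "(\<lambda>z. double_prod (f z) q r) holomorphic_on A"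
  using holomorphic_on_compose_gen[OF assms(1) holomorphic_double_prod_UNIV[OF assms(2,3)]]
  by (simp add: o_def)

text \<open>
  As a function of \<open>x\<close>, the product with \<open>q\<close> and \<open>r\<close> interchanged satisfies the same equation under
  the dilation by \<open>q\<close>; no rearrangement of the double product is needed.
\<close>

lemma double_prod_commute:
  assumes q: "norm q < 1" and r: "norm r < 1"
  shows "double_prod x q r = double_prod x r q"
proof (rule dilation_equation_unique[of q "\<lambda>x. double_prod x q r" "\<lambda>x. qpoch x r"])
  fix x
  have "double_prod x r q = (\<Prod>j. (1 - x * r ^ j) * qpoch (q * x * r ^ j) q)"
    unfolding double_prod_eq_qpoch by (subst qpoch_rec[OF q]) (simp add: mult_ac)
  also have "\<dots> = qpoch x r * double_prod (q * x) r q"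
    unfolding double_prod_eq_qpoch qpoch_def[of x r]
    by (rule prodinf_mult [symmetric])
       (use convergent_prod_qpoch[OF r] convergent_prod_double_prod[OF r q] in auto)
  finally show "double_prod x r q = qpoch x r * double_prod (q * x) r q" .
  show "double_prod x q r = qpoch x r * double_prod (q * x) q r"
    by (rule double_prod_rec[OF q r])
qed (use assms in \<open>auto intro!: isCont_double_prod\<close>)

lemma double_prod_rec':
  assumes "norm q < 1" "norm r < 1"
  shows "double_prod x q r = qpoch x q * double_prod (r * x) q r"
  using double_prod_rec[of r q x] assms by (simp add: double_prod_commute)

text \<open>
  The decomposition of the quadrant of exponents \<open>(j, k)\<close> of \<open>q ^ j * r ^ k\<close> into the cones \<open>j > k\<close>
  and \<open>j \<le> k\<close>, obtained by comparing both sides under the dilation by \<open>q * r\<close>.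
\<close>

lemma double_prod_split:
  assumes q: "norm q < 1" and r: "norm r < 1"
  shows "double_prod x q r = double_prod (q * x) q (q * r) * double_prod x (q * r) r"
proof -
  have qr: "norm (q * r) < 1"
    using mult_strict_mono'[OF q r] by (simp add: norm_mult)
  show ?thesis
  proof (rule dilation_equation_unique[of "q * r" "\<lambda>x. double_prod x q r"
           "\<lambda>x. qpoch (q * x) q * qpoch x r"])
    fix x
    show "double_prod x q r = qpoch (q * x) q * qpoch x r * double_prod (q * r * x) q r"
      using double_prod_rec[OF q r, of x] double_prod_rec'[OF q r, of "q * x"] by (simp add: mult_ac)
    show "double_prod (q * x) q (q * r) * double_prod x (q * r) r =
        qpoch (q * x) q * qpoch x r *
          (double_prod (q * (q * r * x)) q (q * r) * double_prod (q * r * x) (q * r) r)"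
      using double_prod_rec'[OF q qr, of "q * x"] double_prod_rec[OF qr r, of x] by (simp add: mult_ac)
  qed (use qr q r in \<open>auto intro!: isCont_double_prod continuous_intros\<close>)
qed

section \<open>The exponential map and elliptic functions\<close>

text \<open>
  The map \<open>z \<mapsto> e\<^bsup>2\<pi>iz\<^esup>\<close> from the additive to the multiplicative variables.
\<close>

definition nome :: "complex \<Rightarrow> complex" where
  "nome z = exp (2 * of_real pi * \<i> * z)"

lemma nome_0 [simp]: "nome 0 = 1"
  and nome_nonzero [simp]: "nome z \<noteq> 0"
  by (simp_all add: nome_def)

lemma nome_add: "nome (z + w) = nome z * nome w"
  by (simp add: nome_def ring_distribs exp_add)

lemma nome_minus: "nome (- z) = 1 / nome z"
  by (simp add: nome_def exp_minus field_simps)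

lemma nome_diff: "nome (z - w) = nome z / nome w"
  by (simp add: nome_def ring_distribs exp_diff)

lemma nome_of_int_mult: "nome (of_int n * z) = nome z powi n"
  by (simp add: nome_def exp_power_int mult_ac)

lemma nome_of_nat_mult: "nome (of_nat n * z) = nome z ^ n"
  by (simp add: nome_def exp_of_nat_mult [symmetric] mult_ac)

lemma nome_eq_1_iff: "nome z = 1 \<longleftrightarrow> (\<exists>n. z = of_int n)"
  unfolding nome_def by (subst exp_eq_1) (auto simp: complex_eq_iff)

lemma nome_of_int [simp]: "nome (of_int n) = 1"
  by (auto simp: nome_eq_1_iff)

lemma nome_1 [simp]: "nome 1 = 1"
  using nome_of_int[of 1] by simp

lemma nome_half: "nome (1 / 2) = -1"
  by (simp add: nome_def mult.commute)

lemma norm_nome: "norm (nome z) = exp (- 2 * pi * Im z)"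
  by (simp add: nome_def)

lemma norm_nome_less_1_iff [simp]: "norm (nome z) < 1 \<longleftrightarrow> Im z > 0"
  and norm_nome_greater_1_iff [simp]: "norm (nome z) > 1 \<longleftrightarrow> Im z < 0"
  by (auto simp: norm_nome zero_less_mult_iff mult_less_0_iff)

lemma holomorphic_nome [holomorphic_intros]:
  "f holomorphic_on A \<Longrightarrow> (\<lambda>z. nome (f z)) holomorphic_on A"
  unfolding nome_def by (intro holomorphic_intros)

lemma tendsto_nome [tendsto_intros]:
  "(f \<longlongrightarrow> z) F \<Longrightarrow> ((\<lambda>t. nome (f t)) \<longlongrightarrow> nome z) F"
  unfolding nome_def by (intro tendsto_intros)

lemma not_Reals_iff_Im: "z \<notin> \<real> \<longleftrightarrow> Im z > 0 \<or> Im z < 0"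
  by (auto simp: complex_is_Real_iff)

text \<open>
  The set \<open>A\<close> allows periodicity that holds only away from the poles.
\<close>

lemma periodic_on_of_int:
  fixes f :: "complex \<Rightarrow> 'a"
  assumes f: "\<And>z. z \<in> A \<Longrightarrow> f (z + w) = f z"
    and A: "\<And>z. z \<in> A \<Longrightarrow> z + w \<in> A" "\<And>z. z \<in> A \<Longrightarrow> z - w \<in> A" and z: "z \<in> A"
  shows "z + of_int n * w \<in> A \<and> f (z + of_int n * w) = f z"
proof (induction n rule: int_induct[where k = 0])
  case (step1 i)
  thus ?case using f[of "z + of_int i * w"] A(1)[of "z + of_int i * w"] by (simp add: algebra_simps)
next
  case (step2 i)
  thus ?case using f[of "z + of_int i * w - w"] A(2)[of "z + of_int i * w"] by (simp add: algebra_simps)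
qed (use z in auto)

lemma real_coordinates:
  fixes z \<tau> :: complex
  assumes "\<tau> \<notin> \<real>"
  obtains a b :: real where "z = of_real a + of_real b * \<tau>"
proof
  show "z = of_real (Re z - Im z / Im \<tau> * Re \<tau>) + of_real (Im z / Im \<tau>) * \<tau>"
    using assms by (auto simp: complex_eq_iff complex_is_Real_iff)
qed

lemma elliptic_entire_imp_constant:
  assumes hol: "f holomorphic_on UNIV" and \<tau>: "\<tau> \<notin> \<real>"
    and per: "\<And>z. f (z + 1) = f z" "\<And>z. f (z + \<tau>) = f z"
  shows "\<exists>c. \<forall>z. f z = c"
proof -
  define K where "K = (\<lambda>(a::real, b::real). of_real a + of_real b * \<tau>) ` ({0..1} \<times> {0..1})"
  have "compact K"
    unfolding K_def case_prod_unfold by (intro compact_continuous_image continuous_intros compact_Times) auto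
  hence "bounded (f ` K)"
    by (intro compact_imp_bounded compact_continuous_image holomorphic_on_imp_continuous_on)
       (use hol in \<open>auto intro: holomorphic_on_subset\<close>)
  moreover have "range f \<subseteq> f ` K"
  proof safe
    fix z
    obtain a b :: real where z: "z = of_real a + of_real b * \<tau>"
      using real_coordinates[OF \<tau>] .
    define w where "w = of_real (frac a) + of_real (frac b) * \<tau>"
    have "z = w + of_int \<lfloor>a\<rfloor> * 1 + of_int \<lfloor>b\<rfloor> * \<tau>"
      by (simp add: z w_def frac_def algebra_simps)
    hence "f z = f w"
      using periodic_on_of_int[of UNIV f \<tau>] periodic_on_of_int[of UNIV f 1] per by simp
    moreover have "w \<in> K"
      unfolding w_def K_def
      by (intro image_eqI[of _ _ "(frac a, frac b)"]) (auto simp: frac_lt_1 less_imp_le)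
    ultimately show "f z \<in> f ` K" by blast
  qed
  ultimately have "bounded (range f)"
    by (rule bounded_subset)
  from Liouville_theorem[OF hol this] show ?thesis
    by (auto simp: constant_on_def)
qed

section \<open>The theta function and its inversion formula\<close>

text \<open>
  The symbol \<open>(x; q)\<close> for \<open>norm q \<noteq> 1\<close>, extended by \<open>(x; 1 / q) = 1 / (q * x; q)\<close>.
\<close>

definition q_symbol :: "complex \<Rightarrow> complex \<Rightarrow> complex" where
  "q_symbol x q = (if norm q < 1 then qpoch x q else 1 / qpoch (x / q) (1 / q))"

text \<open>
  The theta function \<open>(x; q) * (q / x; q)\<close> in additive variables, for \<open>\<tau>\<close> in either half-plane.
\<close>

definition theta :: "complex \<Rightarrow> complex \<Rightarrow> complex" where
  "theta z \<tau> = q_symbol (nome z) (nome \<tau>) * q_symbol (nome (\<tau> - z)) (nome \<tau>)"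

lemma theta_upper:
  "Im \<tau> > 0 \<Longrightarrow> theta z \<tau> = qpoch (nome z) (nome \<tau>) * qpoch (nome (\<tau> - z)) (nome \<tau>)"
  by (simp add: theta_def q_symbol_def)

lemma theta_uminus_modulus:
  assumes "Im \<tau> > 0"
  shows "theta z (- \<tau>) = 1 / theta (z + \<tau>) \<tau>"
proof -
  have "1 / nome (-\<tau>) = nome \<tau>" "nome z / nome (-\<tau>) = nome (z + \<tau>)" 
    "nome (-\<tau> - z) / nome (-\<tau>) = nome (\<tau> - (z + \<tau>))"
    by (simp_all add: nome_minus nome_add nome_diff)
  thus ?thesis
    using assms by (simp add: theta_def q_symbol_def)
qed

lemma theta_add_1: "theta (z + 1) \<tau> = theta z \<tau>"
  by (simp add: theta_def nome_add nome_diff)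

lemma theta_reflect: "theta (\<tau> - z) \<tau> = theta z \<tau>"
  by (simp add: theta_def)

lemma theta_add_modulus:
  assumes "\<tau> \<notin> \<real>"
  shows "theta (z + \<tau>) \<tau> = - theta z \<tau> / nome z"
proof -
  have upper: "theta (z + \<tau>) \<tau> = - theta z \<tau> / nome z" if \<tau>: "Im \<tau> > 0" for z \<tau>
  proof -
    have q: "norm (nome \<tau>) < 1" using \<tau> by simp
    have "qpoch (nome z) (nome \<tau>) = (1 - nome z) * qpoch (nome (z + \<tau>)) (nome \<tau>)"
      using qpoch_rec[OF q, of "nome z"] by (simp add: nome_add mult_ac)
    moreover have "qpoch (nome (\<tau> - (z + \<tau>))) (nome \<tau>) = (1 - 1 / nome z) * qpoch (nome (\<tau> - z)) (nome \<tau>)"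
      using qpoch_rec[OF q, of "nome (-z)"] by (simp add: nome_diff nome_minus)
    ultimately show ?thesis
      using \<tau> by (simp add: theta_upper) (simp add: field_simps)
  qed
  show ?thesis
  proof (cases "Im \<tau> > 0")
    case False
    hence \<tau>: "Im (- \<tau>) > 0" using assms by (auto simp: complex_is_Real_iff)
    have "theta z \<tau> = 1 / theta (z + (-\<tau>)) (-\<tau>)" "theta (z + \<tau>) \<tau> = 1 / theta z (-\<tau>)"
      using theta_uminus_modulus[OF \<tau>, of z] theta_uminus_modulus[OF \<tau>, of "z + \<tau>"] by simp_all
    thus ?thesis
      unfolding upper[OF \<tau>] by simp
  qed (rule upper)
qed

lemma theta_eq_0_iff:
  assumes \<tau>: "Im \<tau> > 0"
  shows "theta z \<tau> = 0 \<longleftrightarrow> (\<exists>m n :: int. z = of_int m + of_int n * \<tau>)"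
proof
  assume "theta z \<tau> = 0"
  hence "qpoch (nome z) (nome \<tau>) = 0 \<or> qpoch (nome (\<tau> - z)) (nome \<tau>) = 0"
    using \<tau> by (simp add: theta_upper)
  then obtain k where "nome z * nome \<tau> ^ k = 1 \<or> nome (\<tau> - z) * nome \<tau> ^ k = 1"
    using \<tau> by (auto simp: qpoch_eq_0_iff)
  hence "nome (z + of_nat k * \<tau>) = 1 \<or> nome (\<tau> - z + of_nat k * \<tau>) = 1"
    by (simp add: nome_add nome_of_nat_mult)
  then obtain n where "z + of_nat k * \<tau> = of_int n \<or> \<tau> - z + of_nat k * \<tau> = of_int n"
    by (auto simp: nome_eq_1_iff)
  hence "z = of_int n + of_int (- int k) * \<tau> \<or> z = of_int (-n) + of_int (int k + 1) * \<tau>"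
    by (auto simp: algebra_simps)
  thus "\<exists>m n :: int. z = of_int m + of_int n * \<tau>" by blast
next
  assume "\<exists>m n :: int. z = of_int m + of_int n * \<tau>"
  then obtain m n :: int where z: "z = of_int m + of_int n * \<tau>" by blast
  show "theta z \<tau> = 0"
  proof (cases "n \<le> 0")
    case True
    hence "nome z * nome \<tau> ^ nat (-n) = 1"
      by (simp add: z nome_add nome_of_int_mult power_int_def nome_minus divide_simps)
    thus ?thesis using \<tau> by (auto simp: theta_upper qpoch_eq_0_iff)
  next
    case False
    have "nome (\<tau> - z) * nome \<tau> ^ nat (n - 1) = nome (\<tau> - z + of_int (n - 1) * \<tau>)"
      unfolding nome_add nome_of_int_mult using False by (simp add: power_int_def)
    also have "\<tau> - z + of_int (n - 1) * \<tau> = of_int (-m)"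
      by (simp add: z algebra_simps)
    also have "nome \<dots> = 1" by (rule nome_of_int)
    finally show ?thesis using \<tau> by (auto simp: theta_upper qpoch_eq_0_iff)
  qed
qed

lemma holomorphic_theta [holomorphic_intros]:
  assumes "f holomorphic_on A" "Im \<tau> > 0"
  shows "(\<lambda>z. theta (f z) \<tau>) holomorphic_on A"
  using assms by (simp add: theta_upper) (intro holomorphic_intros; simp)

lemma qpoch_square_base:
  assumes q: "norm q < 1"
  shows "qpoch x q = qpoch x (q\<^sup>2) * qpoch (q * x) (q\<^sup>2)"
proof (rule dilation_equation_unique[of "q\<^sup>2" "\<lambda>x. qpoch x q" "\<lambda>x. (1 - x) * (1 - q * x)"])
  have q2: "norm (q\<^sup>2) < 1" using q by (simp add: norm_power power_less_one_iff)
  show "norm (q\<^sup>2) < 1" by (rule q2)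
  fix x
  show "qpoch x q = (1 - x) * (1 - q * x) * qpoch (q\<^sup>2 * x) q"
    using qpoch_rec[OF q, of x] qpoch_rec[OF q, of "q * x"] by (simp add: power2_eq_square mult_ac)
  show "qpoch x (q\<^sup>2) * qpoch (q * x) (q\<^sup>2) =
    (1 - x) * (1 - q * x) * (qpoch (q\<^sup>2 * x) (q\<^sup>2) * qpoch (q * (q\<^sup>2 * x)) (q\<^sup>2))"
    using qpoch_rec[OF q2, of x] qpoch_rec[OF q2, of "q * x"] by (simp add: mult_ac)
  show "isCont (\<lambda>x. qpoch x (q\<^sup>2) * qpoch (q * x) (q\<^sup>2)) 0"
    by (intro continuous_intros isCont_qpoch q2)
qed (use q in \<open>auto intro!: isCont_qpoch\<close>)

lemma qpoch_mult_uminus: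
  assumes q: "norm q < 1"
  shows "qpoch x q * qpoch (- x) q = qpoch (x\<^sup>2) (q\<^sup>2)"
proof -
  have q2: "norm (q\<^sup>2) < 1" using q by (simp add: norm_power power_less_one_iff)
  have "qpoch x q * qpoch (- x) q = (\<Prod>k. (1 - x * q ^ k) * (1 - (- x) * q ^ k))"
    unfolding qpoch_def by (rule prodinf_mult) (intro convergent_prod_qpoch q)+
  also have "\<dots> = qpoch (x\<^sup>2) (q\<^sup>2)"
    unfolding qpoch_def
    by (intro prodinf_cong) (simp add: algebra_simps power2_eq_square power_mult_distrib)
  finally show ?thesis .
qed

text \<open>
  With \<open>p\<^sup>2 = q\<close> this is Euler's identity \<open>(- q; q) * (q; q\<^sup>2) = 1\<close>, squared and doubled.
\<close>

lemma theta_half_periods: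
  assumes \<tau>: "Im \<tau> > 0"
  shows "theta (1 / 2) \<tau> * theta (\<tau> / 2) \<tau> * theta ((1 + \<tau>) / 2) \<tau> = 2"
proof -
  define p where "p = nome (\<tau> / 2)"
  have p2: "nome \<tau> = p\<^sup>2"
    using nome_add[of "\<tau> / 2" "\<tau> / 2"] by (simp add: p_def power2_eq_square)
  have p: "norm p < 1"
    using \<tau> by (simp add: p_def)
  have q: "norm (p\<^sup>2) < 1"
    using \<tau> by (simp flip: p2)
  have q2: "norm ((p\<^sup>2)\<^sup>2) < 1"
    using q by (simp add: norm_power power_less_one_iff)
  have t1: "theta (1 / 2) \<tau> = 2 * (qpoch (- (p\<^sup>2)) (p\<^sup>2))\<^sup>2"
  proof -
    have "theta (1 / 2) \<tau> = qpoch (-1) (p\<^sup>2) * qpoch (- (p\<^sup>2)) (p\<^sup>2)"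
      using \<tau> by (simp add: theta_upper nome_diff nome_half p2)
    also have "qpoch (-1) (p\<^sup>2) = 2 * qpoch (- (p\<^sup>2)) (p\<^sup>2)"
      using qpoch_rec[OF q, of "-1"] by simp
    finally show ?thesis by (simp add: power2_eq_square)
  qed
  have t2: "theta (\<tau> / 2) \<tau> = (qpoch p (p\<^sup>2))\<^sup>2"
  proof -
    have "nome (\<tau> - \<tau> / 2) = p"
      unfolding p_def by (rule arg_cong[of _ _ nome]) (simp add: field_simps)
    thus ?thesis
      using \<tau> by (simp add: theta_upper p2 power2_eq_square flip: p_def)
  qed
  have t3: "theta ((1 + \<tau>) / 2) \<tau> = (qpoch (- p) (p\<^sup>2))\<^sup>2"
  proof -
    have *: "nome ((1 + \<tau>) / 2) = - p"
      by (simp add: add_divide_distrib nome_add nome_half p_def)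
    hence "nome (\<tau> - (1 + \<tau>) / 2) = - p"
      by (simp add: nome_diff p2 power2_eq_square p_def)
    thus ?thesis
      using \<tau> * by (simp add: theta_upper p2 power2_eq_square)
  qed
  have pm: "qpoch p (p\<^sup>2) * qpoch (- p) (p\<^sup>2) = qpoch (p\<^sup>2) ((p\<^sup>2)\<^sup>2)"
    by (rule qpoch_mult_uminus[OF q])
  have "qpoch (- (p\<^sup>2)) (p\<^sup>2) * qpoch (p\<^sup>2) ((p\<^sup>2)\<^sup>2) = 1"
  proof -
    have "p\<^sup>2 * (p\<^sup>2) ^ k \<noteq> 1" for k
    proof
      assume "p\<^sup>2 * (p\<^sup>2) ^ k = 1"
      hence "norm (p\<^sup>2) ^ Suc k = 1"
        by (metis norm_one norm_power power_Suc)
      thus False using q power_less_one_iff[of "norm (p\<^sup>2)" "Suc k"] by simp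
    qed
    hence nz: "qpoch (p\<^sup>2) (p\<^sup>2) \<noteq> 0"
      by (simp add: qpoch_eq_0_iff[OF q])
    have "qpoch (p\<^sup>2) (p\<^sup>2) = qpoch (p\<^sup>2) ((p\<^sup>2)\<^sup>2) * qpoch ((p\<^sup>2)\<^sup>2) ((p\<^sup>2)\<^sup>2)"
      using qpoch_square_base[OF q, of "p\<^sup>2"] by (simp add: power2_eq_square)
    also have "qpoch ((p\<^sup>2)\<^sup>2) ((p\<^sup>2)\<^sup>2) = qpoch (p\<^sup>2) (p\<^sup>2) * qpoch (- (p\<^sup>2)) (p\<^sup>2)"
      using qpoch_mult_uminus[OF q, of "p\<^sup>2"] by simp
    finally show ?thesis using nz by (simp add: mult_ac)
  qed
  hence "(qpoch (- (p\<^sup>2)) (p\<^sup>2) * (qpoch p (p\<^sup>2) * qpoch (- p) (p\<^sup>2)))\<^sup>2 = 1"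
    by (simp add: pm)
  thus ?thesis
    by (simp add: t1 t2 t3 power_mult_distrib mult_ac)
qed

text \<open>
  The quadratic polynomial in the exponent of the modular transformation of \<^const>\<open>theta\<close>.
\<close>

definition theta_exponent :: "complex \<Rightarrow> complex \<Rightarrow> complex" where
  "theta_exponent z \<tau> = z\<^sup>2 / \<tau> + z * (1 / \<tau> - 1) + (\<tau> + 1 / \<tau>) / 6 - 1 / 2"

lemma exp_pi_odd: "exp (\<i> * of_real pi * (2 * w + 1)) = - nome w"
  by (simp add: nome_def ring_distribs exp_add mult_ac exp_pi_i')

lemma exp_pi_odd': "exp (\<i> * of_real pi * (2 * w - 1)) = - nome w"
  using exp_pi_odd[of "w - 1"] by (simp add: nome_diff algebra_simps)

text \<open>
  The inversion formula of the theta function, up to a cube root of unity \<open>c\<close>. Both sides have the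
  same multipliers under the translations by \<open>1\<close> and \<open>\<tau>\<close> and the same simple zeros, so their
  quotient extends to an entire elliptic function and is constant. The three nontrivial half-periods
  are permuted by the inversion up to periods, and the product of the theta values there does not depend on \<open>\<tau>\<close>,
  which gives \<open>c ^ 3 = 1\<close>. In fact \<open>c = 1\<close>, but the cube suffices for the application.
\<close>

lemma theta_modular_upper:
  assumes \<tau>: "Im \<tau> > 0"
  obtains c where "c ^ 3 = 1"
    "\<And>z. theta (z / \<tau>) (- 1 / \<tau>) = c * exp (\<i> * of_real pi * theta_exponent z \<tau>) * theta z \<tau>"
proof -
  have \<tau>0: "\<tau> \<noteq> 0" using \<tau> by auto
  define s where "s = - 1 / \<tau>"
  have s: "Im s > 0"
    using \<tau> by (simp add: s_def Im_divide sum_power2_gt_zero_iff)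
  have s': "s \<notin> \<real>" "\<tau> \<notin> \<real>"
    using s \<tau> by (auto simp: complex_is_Real_iff)
  define h where "h = (\<lambda>z. theta (z / \<tau>) s)"
  define E where "E = (\<lambda>z. exp (\<i> * of_real pi * theta_exponent z \<tau>))"
  define g where "g = (\<lambda>z. E z * theta z \<tau>)"
  have E_nz: "E z \<noteq> 0" for z by (simp add: E_def)
  have hol: "h holomorphic_on UNIV" "g holomorphic_on UNIV"
    unfolding h_def g_def E_def theta_exponent_def using \<tau>0 s \<tau> by (auto intro!: holomorphic_intros)
  have g_0_iff: "g z = 0 \<longleftrightarrow> (\<exists>m n :: int. z = of_int m + of_int n * \<tau>)" for z
    using theta_eq_0_iff[OF \<tau>] by (simp add: g_def E_nz)
  have h_0_iff: "h z = 0 \<longleftrightarrow> (\<exists>m n :: int. z = of_int m + of_int n * \<tau>)" for z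
  proof -
    have "z / \<tau> = of_int m + of_int n * s \<longleftrightarrow> z = of_int (-n) + of_int m * \<tau>" for m n :: int
      using \<tau>0 by (auto simp: s_def field_simps)
    hence "h z = 0 \<longleftrightarrow> (\<exists>m n :: int. z = of_int (-n) + of_int m * \<tau>)"
      using theta_eq_0_iff[OF s, of "z / \<tau>"] unfolding h_def by simp
    also have "\<dots> \<longleftrightarrow> (\<exists>m n :: int. z = of_int m + of_int n * \<tau>)"
      by (metis minus_minus)
    finally show ?thesis .
  qed
  have h_add_\<tau>: "h (z + \<tau>) = h z" for z
    using theta_add_1[of "z / \<tau>" s] \<tau>0 by (simp add: h_def add_divide_distrib)
  have h_add_1: "h (z + 1) = - nome ((z + 1) / \<tau>) * h z" for z
  proof -
    have "h z = theta ((z + 1) / \<tau> + s) s"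
      unfolding h_def by (rule arg_cong[of _ _ "\<lambda>w. theta w s"]) (simp add: s_def add_divide_distrib)
    also have "\<dots> = - h (z + 1) / nome ((z + 1) / \<tau>)"
      by (subst theta_add_modulus[OF s'(1)]) (simp add: h_def)
    finally show ?thesis by simp
  qed
  have g_add_\<tau>: "g (z + \<tau>) = g z" for z
  proof -
    have "theta_exponent (z + \<tau>) \<tau> = theta_exponent z \<tau> + (2 * z + 1)"
      using \<tau>0 by (simp add: theta_exponent_def field_simps power2_eq_square)
    hence "E (z + \<tau>) = E z * (- nome z)"
      unfolding E_def by (simp only: ring_distribs(1) exp_add exp_pi_odd[symmetric])
    thus ?thesis
      using theta_add_modulus[OF s'(2), of z] by (simp add: g_def)
  qed
  have g_add_1: "g (z + 1) = - nome ((z + 1) / \<tau>) * g z" for z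
  proof -
    have "theta_exponent (z + 1) \<tau> = theta_exponent z \<tau> + (2 * ((z + 1) / \<tau>) - 1)"
      using \<tau>0 by (simp add: theta_exponent_def field_simps power2_eq_square)
    hence "E (z + 1) = E z * (- nome ((z + 1) / \<tau>))"
      unfolding E_def by (simp only: ring_distribs(1) exp_add exp_pi_odd'[symmetric])
    thus ?thesis
      using theta_add_1[of z \<tau>] by (simp add: g_def)
  qed
  define k where "k = (\<lambda>z. h z / g z)"
  have k_per: "k (z + 1) = k z" "k (z + \<tau>) = k z" for z
    by (simp_all add: k_def h_add_1 g_add_1 h_add_\<tau> g_add_\<tau>)
  have k_per': "k (z + (of_int m + of_int n * \<tau>)) = k z" for z and m n :: int
    using periodic_on_of_int[of UNIV k \<tau>] periodic_on_of_int[of UNIV k 1] k_per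
    by (simp flip: add.assoc)
  have k_mero: "k meromorphic_on UNIV"
    unfolding k_def using hol by (intro meromorphic_intros analytic_on_imp_meromorphic_on) 
      (auto simp: analytic_on_open)
  \<comment> \<open>The simple zero of \<open>theta z \<tau>\<close> at the origin is the factor \<open>1 - nome z\<close>; \<open>u\<close> is the rest.\<close>
  have "\<exists>c. k \<midarrow>0\<rightarrow> c"
  proof -
    have nz1: "qpoch (nome \<tau> * 1) (nome \<tau>) \<noteq> 0" if "Im \<tau> > 0" for \<tau>
    proof -
      have "norm (nome \<tau> ^ Suc k) < 1" for k
        using that by (subst norm_power, subst power_less_one_iff) auto
      hence "nome \<tau> ^ Suc k \<noteq> 1" for k by (metis norm_one less_irrefl)
      thus ?thesis using that by (auto simp: qpoch_eq_0_iff)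
    qed
    define u where "u = (\<lambda>z \<tau>. qpoch (nome \<tau> * nome z) (nome \<tau>) * qpoch (nome (\<tau> - z)) (nome \<tau>))"
    have theta_u: "theta z \<tau> = (1 - nome z) * u z \<tau>" if "Im \<tau> > 0" for z \<tau>
      using that qpoch_rec[of "nome \<tau>" "nome z"] by (simp add: theta_upper u_def)
    have u0: "u 0 \<tau> \<noteq> 0" if "Im \<tau> > 0" for \<tau>
      using nz1[OF that] by (simp add: u_def)
    have tu: "((\<lambda>z. u (a * z) \<tau>) \<longlongrightarrow> u 0 \<tau>) (at 0)" if "Im \<tau> > 0" for \<tau> a
      unfolding u_def using that by (auto intro!: tendsto_eq_intros)
    have "((\<lambda>z. (1 - nome (z / \<tau>)) / (1 - nome z)) \<longlongrightarrow> 1 / \<tau>) (at 0)"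
    proof (rule lhopital_complex_simple[where f' = "- (2 * of_real pi * \<i> / \<tau>)" and g' = "- (2 * of_real pi * \<i>)"])
      show "((\<lambda>z. 1 - nome (z / \<tau>)) has_field_derivative - (2 * of_real pi * \<i> / \<tau>)) (at 0)"
        "((\<lambda>z. 1 - nome z) has_field_derivative - (2 * of_real pi * \<i>)) (at 0)"
        unfolding nome_def using \<tau>0 by (auto intro!: derivative_eq_intros)
    qed auto
    moreover have "((\<lambda>z. u (1 / \<tau> * z) s / (E z * u (1 * z) \<tau>)) \<longlongrightarrow> u 0 s / (E 0 * u 0 \<tau>)) (at 0)"
      using E_nz u0[OF \<tau>] \<tau>0 unfolding E_def theta_exponent_def
      by (intro tendsto_intros tu s \<tau>) auto
    ultimately have "((\<lambda>z. (1 - nome (z / \<tau>)) / (1 - nome z) * (u (1 / \<tau> * z) s / (E z * u (1 * z) \<tau>)))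
        \<longlongrightarrow> 1 / \<tau> * (u 0 s / (E 0 * u 0 \<tau>))) (at 0)"
      by (rule tendsto_mult)
    moreover have "(\<lambda>z. (1 - nome (z / \<tau>)) / (1 - nome z) * (u (1 / \<tau> * z) s / (E z * u (1 * z) \<tau>))) = k"
      by (auto simp: fun_eq_iff k_def h_def g_def theta_u[OF s] theta_u[OF \<tau>] mult_ac)
    ultimately show ?thesis by metis
  qed
  then obtain l where l: "k \<midarrow>0\<rightarrow> l" by blast
  define K where "K = remove_sings k"
  have K_per: "K (z + w) = K z" if "\<And>z. k (z + w) = k z" for z w
  proof -
    have "(k \<longlongrightarrow> c) (at (z + w)) \<longleftrightarrow> (k \<longlongrightarrow> c) (at z)" for c
      using that by (subst at_to_0, subst (2) at_to_0)
        (simp add: filterlim_filtermap add.assoc flip: add.assoc add.commute[of z] )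
    thus ?thesis
      unfolding K_def by (cases "\<exists>c. (k \<longlongrightarrow> c) (at z)")
        (auto simp: remove_sings_def[where f = k] tendsto_Lim)
  qed
  have k_ana: "k analytic_on {z}" if "g z \<noteq> 0" for z
    unfolding k_def using that hol by (intro analytic_intros) (auto intro: holomorphic_on_imp_analytic_at)
  have K_eq: "K z = k z" if "g z \<noteq> 0" for z
    unfolding K_def using k_ana[OF that] by simp
  have "K analytic_on {z}" for z
  proof (cases "g z = 0")
    case False
    thus ?thesis unfolding K_def by (intro remove_sings_analytic_on k_ana)
  next
    case True
    then obtain m n :: int where z: "z = of_int m + of_int n * \<tau>" using g_0_iff by blast
    have "filtermap (\<lambda>w. w + z) (at 0) = at z"
      using at_to_0[of z] by simp
    hence "(k \<longlongrightarrow> l) (at z) \<longleftrightarrow> ((\<lambda>w. k (w + z)) \<longlongrightarrow> l) (at 0)"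
      by (metis filterlim_filtermap)
    also have "(\<lambda>w. k (w + z)) = k"
      unfolding z using k_per' by blast
    finally have "k \<midarrow>z\<rightarrow> l" using l by simp
    moreover have "isolated_singularity_at k z"
      using k_mero by (meson UNIV_I meromorphic_on_isolated_singularity meromorphic_on_subset subset_UNIV)
    ultimately show ?thesis unfolding K_def by (intro remove_sings_analytic_at)
  qed
  hence "K holomorphic_on UNIV"
    by (metis analytic_imp_holomorphic analytic_on_analytic_at UNIV_I)
  then obtain c where c: "K z = c" for z
    using elliptic_entire_imp_constant[of K \<tau>] s' K_per k_per by metis
  have hg: "h z = c * g z" for z
  proof (cases "g z = 0")
    case False
    thus ?thesis using K_eq[of z] c by (simp add: k_def field_simps)
  next
    case True
    hence "h z = 0" unfolding g_0_iff h_0_iff .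
    thus ?thesis using True by simp
  qed
  show ?thesis
  proof
    show "theta (z / \<tau>) (- 1 / \<tau>) = c * exp (\<i> * of_real pi * theta_exponent z \<tau>) * theta z \<tau>" for z
      using hg[of z] by (simp add: h_def g_def E_def s_def)
    have "2 = theta (1 / 2) s * theta (s / 2) s * theta ((1 + s) / 2) s"
      using theta_half_periods[OF s] by simp
    also have "theta (1 / 2) s = h (\<tau> / 2)"
      using \<tau>0 by (simp add: h_def)
    also have "theta (s / 2) s = - h (1 / 2) * nome (s / 2)"
    proof -
      have "theta (s / 2) s = theta (- s / 2 + s) s" by simp
      also have "\<dots> = - theta (- s / 2) s * nome (s / 2)"
        by (subst theta_add_modulus[OF s'(1)]) (simp add: nome_minus)
      also have "- s / 2 = 1 / 2 / \<tau>" by (simp add: s_def)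
      finally show ?thesis by (simp add: h_def)
    qed
    also have "theta ((1 + s) / 2) s = h ((1 + \<tau>) / 2) * nome (s / 2)"
    proof -
      have "(1 + s) / 2 = (1 / 2 - s / 2) + s" by (simp add: field_simps)
      hence "theta ((1 + s) / 2) s = theta ((1 / 2 - s / 2) + s) s" by (rule arg_cong)
      also have "\<dots> = theta (1 / 2 - s / 2) s * nome (s / 2)"
        by (subst theta_add_modulus[OF s'(1)]) (simp add: nome_diff nome_half)
      also have "1 / 2 - s / 2 = (1 + \<tau>) / 2 / \<tau>"
        using \<tau>0 by (simp add: s_def field_simps)
      finally show ?thesis by (simp add: h_def)
    qed
    also have "h (\<tau> / 2) * (- h (1 / 2) * nome (s / 2)) * (h ((1 + \<tau>) / 2) * nome (s / 2)) =
        - (c ^ 3) * (nome (s / 2) * nome (s / 2)) * (E (1 / 2) * E (\<tau> / 2) * E ((1 + \<tau>) / 2)) *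
        (theta (1 / 2) \<tau> * theta (\<tau> / 2) \<tau> * theta ((1 + \<tau>) / 2) \<tau>)"
      by (simp add: hg g_def power3_eq_cube mult_ac)
    also have "nome (s / 2) * nome (s / 2) = nome s"
      by (simp flip: nome_add)
    also have "E (1 / 2) * E (\<tau> / 2) * E ((1 + \<tau>) / 2) = - nome (- s)"
    proof -
      have "theta_exponent (1 / 2) \<tau> + theta_exponent (\<tau> / 2) \<tau> + theta_exponent ((1 + \<tau>) / 2) \<tau>
              = 2 * (- s) - 1"
        using \<tau>0 by (simp add: theta_exponent_def s_def field_simps power2_eq_square)
      thus ?thesis
        unfolding exp_pi_odd'[symmetric] E_def by (simp flip: exp_add ring_distribs)
    qed
    finally show "c ^ 3 = 1"
      using theta_half_periods[OF \<tau>] by (simp add: nome_minus)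
  qed
qed

lemma theta_modular:
  assumes \<tau>: "\<tau> \<notin> \<real>"
  obtains c where "c ^ 3 = 1"
    "\<And>z. theta (z / \<tau>) (- 1 / \<tau>) = c * exp (\<i> * of_real pi * theta_exponent z \<tau>) * theta z \<tau>"
proof (cases "Im \<tau> > 0")
  case True
  thus ?thesis using theta_modular_upper that by metis
next
  case False
  define t where "t = - \<tau>"
  have t: "Im t > 0" using False \<tau> by (auto simp: t_def complex_is_Real_iff)
  have t0: "t \<noteq> 0" using t by auto
  have t': "Im (- 1 / t) > 0"
    using t by (simp add: Im_divide sum_power2_gt_zero_iff)
  obtain c where c: "c ^ 3 = 1"
    "\<And>z. theta (z / t) (- 1 / t) = c * exp (\<i> * of_real pi * theta_exponent z t) * theta z t"
    using theta_modular_upper[OF t] by blast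
  show ?thesis
  proof
    show "(1 / c) ^ 3 = 1" using c(1) by (simp add: power_divide)
    fix z
    have "theta (z / \<tau>) (- 1 / \<tau>) = theta (- z / t) (- (- 1 / t))"
      by (simp add: t_def)
    also have "\<dots> = 1 / theta (- z / t + - 1 / t) (- 1 / t)"
      by (rule theta_uminus_modulus[OF t'])
    also have "- z / t + - 1 / t = (- (z + 1)) / t"
      using t0 by (simp add: field_simps)
    also have "theta (- (z + 1) / t) (- 1 / t) =
                 c * exp (\<i> * of_real pi * theta_exponent (- (z + 1)) t) * theta (- (z + 1)) t"
      by (rule c(2))
    also have "theta_exponent (- (z + 1)) t = - theta_exponent z \<tau>"
      using t0 by (simp add: theta_exponent_def t_def field_simps power2_eq_square)
    also have "theta (- (z + 1)) t = theta (z + t + 1) t"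
      using theta_reflect[of t "- (z + 1)"] by (simp add: algebra_simps)
    also have "\<dots> = 1 / theta z \<tau>"
      using theta_uminus_modulus[OF t, of z] by (simp add: theta_add_1 t_def)
    finally show "theta (z / \<tau>) (- 1 / \<tau>) =
        1 / c * exp (\<i> * of_real pi * theta_exponent z \<tau>) * theta z \<tau>"
      by (simp add: exp_minus field_simps)
  qed
qed

section \<open>The group of periods\<close>

text \<open>
  The group generated by \<open>1\<close>, \<open>\<tau>\<close> and \<open>\<sigma>\<close>. It contains all zeros and poles, in \<open>z\<close>, of the
  three gamma functions in the modular relation. It need not be discrete, but it is countable,
  and off this group the functional equations hold between nonzero numbers.
\<close>

definition period_group :: "complex \<Rightarrow> complex \<Rightarrow> complex set" where
  "period_group \<tau> \<sigma> = {of_int l + of_int m * \<tau> + of_int n * \<sigma> | l m n. True}"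

lemma period_groupI [intro]: "of_int l + of_int m * \<tau> + of_int n * \<sigma> \<in> period_group \<tau> \<sigma>"
  by (auto simp: period_group_def)

lemma period_group_add:
  assumes "z \<in> period_group \<tau> \<sigma>" "w \<in> period_group \<tau> \<sigma>"
  shows "z + w \<in> period_group \<tau> \<sigma>"
proof -
  obtain a b c d e f :: int where "z = of_int a + of_int b * \<tau> + of_int c * \<sigma>"
      "w = of_int d + of_int e * \<tau> + of_int f * \<sigma>"
    using assms by (auto simp: period_group_def)
  hence "z + w = of_int (a + d) + of_int (b + e) * \<tau> + of_int (c + f) * \<sigma>"
    by (simp add: algebra_simps)
  thus ?thesis by (metis period_groupI)
qed

lemma period_group_uminus_iff [simp]: "- z \<in> period_group \<tau> \<sigma> \<longleftrightarrow> z \<in> period_group \<tau> \<sigma>"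
proof -
  have "- z \<in> period_group \<tau> \<sigma>" if z: "z \<in> period_group \<tau> \<sigma>" for z
  proof -
    obtain a b c :: int where "z = of_int a + of_int b * \<tau> + of_int c * \<sigma>"
      using z by (auto simp: period_group_def)
    hence "- z = of_int (- a) + of_int (- b) * \<tau> + of_int (- c) * \<sigma>" by simp
    thus ?thesis by (metis period_groupI)
  qed
  from this[of z] this[of "-z"] show ?thesis by auto
qed

lemma period_group_add_iff [simp]:
  assumes "w \<in> period_group \<tau> \<sigma>"
  shows "z + w \<in> period_group \<tau> \<sigma> \<longleftrightarrow> z \<in> period_group \<tau> \<sigma>"
    and "w + z \<in> period_group \<tau> \<sigma> \<longleftrightarrow> z \<in> period_group \<tau> \<sigma>"
    and "z - w \<in> period_group \<tau> \<sigma> \<longleftrightarrow> z \<in> period_group \<tau> \<sigma>"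
    and "w - z \<in> period_group \<tau> \<sigma> \<longleftrightarrow> z \<in> period_group \<tau> \<sigma>"
proof -
  have w: "- w \<in> period_group \<tau> \<sigma>" using assms by simp
  have 1: "z + w \<in> period_group \<tau> \<sigma> \<longleftrightarrow> z \<in> period_group \<tau> \<sigma>" for z
    using period_group_add[OF _ assms, of z] period_group_add[OF _ w, of "z + w"] by auto
  show "z + w \<in> period_group \<tau> \<sigma> \<longleftrightarrow> z \<in> period_group \<tau> \<sigma>"
    by (rule 1)
  show "w + z \<in> period_group \<tau> \<sigma> \<longleftrightarrow> z \<in> period_group \<tau> \<sigma>"
    using 1[of z] by (simp add: add.commute)
  show "z - w \<in> period_group \<tau> \<sigma> \<longleftrightarrow> z \<in> period_group \<tau> \<sigma>"
    using 1[of "z - w"] by simp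
  show "w - z \<in> period_group \<tau> \<sigma> \<longleftrightarrow> z \<in> period_group \<tau> \<sigma>"
    using 1[of "- z"] by simp
qed

lemma period_group_generators [simp]:
  "of_int l \<in> period_group \<tau> \<sigma>" "1 \<in> period_group \<tau> \<sigma>"
  "of_int m * \<tau> \<in> period_group \<tau> \<sigma>" "\<tau> \<in> period_group \<tau> \<sigma>" 
  "of_int n * \<sigma> \<in> period_group \<tau> \<sigma>" "\<sigma> \<in> period_group \<tau> \<sigma>"
  using period_groupI[of l 0 \<tau> 0 \<sigma>] period_groupI[of 1 0 \<tau> 0 \<sigma>]
    period_groupI[of 0 m \<tau> 0 \<sigma>] period_groupI[of 0 1 \<tau> 0 \<sigma>]
    period_groupI[of 0 0 \<tau> n \<sigma>] period_groupI[of 0 0 \<tau> 1 \<sigma>] by simp_all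

lemma period_group_of_int_mult:
  assumes "w \<in> period_group \<tau> \<sigma>"
  shows "of_int n * w \<in> period_group \<tau> \<sigma>"
proof -
  obtain a b c :: int where "w = of_int a + of_int b * \<tau> + of_int c * \<sigma>"
    using assms by (auto simp: period_group_def)
  hence "of_int n * w = of_int (n * a) + of_int (n * b) * \<tau> + of_int (n * c) * \<sigma>"
    by (simp add: algebra_simps)
  thus ?thesis by (metis period_groupI)
qed

lemma period_group_subset:
  assumes "\<tau>' \<in> period_group \<tau> \<sigma>" "\<sigma>' \<in> period_group \<tau> \<sigma>"
  shows "period_group \<tau>' \<sigma>' \<subseteq> period_group \<tau> \<sigma>"
  unfolding period_group_def[of \<tau>']
  using assms by (auto intro!: period_group_add period_group_of_int_mult)

lemma period_group_commute: "period_group \<tau> \<sigma> = period_group \<sigma> \<tau>"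
  by (intro equalityI period_group_subset) simp_all

lemma period_group_uminus_left [simp]: "period_group (- \<tau>) \<sigma> = period_group \<tau> \<sigma>"
  by (rule equalityI; rule period_group_subset)
    (use period_group_uminus_iff[of "\<tau>" "- \<tau>" \<sigma>] in simp_all)

lemma period_group_uminus_right [simp]: "period_group \<tau> (- \<sigma>) = period_group \<tau> \<sigma>"
  using period_group_uminus_left[of \<sigma> \<tau>] by (simp add: period_group_commute)

lemma period_group_shear: "period_group \<tau> (\<tau> + \<sigma>) = period_group \<tau> \<sigma>"
proof (rule equalityI; rule period_group_subset)
  have "(\<tau> + \<sigma>) - \<tau> \<in> period_group \<tau> (\<tau> + \<sigma>)"
    by (subst period_group_add_iff) simp_all
  thus "\<sigma> \<in> period_group \<tau> (\<tau> + \<sigma>)" by simp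
qed simp_all

text \<open>
  Multiplication by \<open>\<omega>\<close> maps one group into another if it does so with the three generators.
\<close>

lemma period_group_mult:
  assumes "\<omega> \<in> period_group \<tau> \<sigma>" "\<tau>' * \<omega> \<in> period_group \<tau> \<sigma>" "\<sigma>' * \<omega> \<in> period_group \<tau> \<sigma>"
    and z: "z \<in> period_group \<tau>' \<sigma>'"
  shows "z * \<omega> \<in> period_group \<tau> \<sigma>"
proof -
  obtain a b c :: int where "z = of_int a + of_int b * \<tau>' + of_int c * \<sigma>'"
    using z by (auto simp: period_group_def)
  hence "z * \<omega> = of_int a * \<omega> + of_int b * (\<tau>' * \<omega>) + of_int c * (\<sigma>' * \<omega>)"
    by (simp add: algebra_simps)
  thus ?thesis
    using assms by (simp only: period_group_add period_group_of_int_mult)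
qed

lemma countable_period_group: "countable (period_group \<tau> \<sigma>)"
proof -
  have "period_group \<tau> \<sigma> = (\<lambda>(l, m, n). of_int l + of_int m * \<tau> + of_int n * \<sigma>) ` UNIV"
    by (auto simp: period_group_def image_iff) metis
  thus ?thesis by simp
qed

section \<open>The double symbol for nonreal parameters\<close>

text \<open>
  The symbol \<open>(x; q, r)\<close> in additive variables, for all nonreal parameters.
\<close>

definition nome_symbol :: "complex \<Rightarrow> complex \<Rightarrow> complex \<Rightarrow> complex" where
  "nome_symbol z \<tau> \<sigma> = qr_symbol (nome z) (nome \<tau>) (nome \<sigma>)"

text \<open>
  The double product in additive variables, meaningful for parameters in the upper half-plane.
\<close>

definition nome_prod :: "complex \<Rightarrow> complex \<Rightarrow> complex \<Rightarrow> complex" where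
  "nome_prod z \<tau> \<sigma> = double_prod (nome z) (nome \<tau>) (nome \<sigma>)"

lemma elliptic_gamma_eq: "elliptic_gamma z \<tau> \<sigma> = nome_symbol (\<tau> + \<sigma> - z) \<tau> \<sigma> / nome_symbol z \<tau> \<sigma>"
  by (simp add: elliptic_gamma_def nome_symbol_def nome_add nome_diff Let_def flip: nome_def)

lemma nome_symbol_eq:
  "Im \<tau> > 0 \<Longrightarrow> Im \<sigma> > 0 \<Longrightarrow> nome_symbol z \<tau> \<sigma> = nome_prod z \<tau> \<sigma>"
  "Im \<tau> < 0 \<Longrightarrow> Im \<sigma> > 0 \<Longrightarrow> nome_symbol z \<tau> \<sigma> = 1 / nome_prod (z - \<tau>) (- \<tau>) \<sigma>"
  "Im \<tau> > 0 \<Longrightarrow> Im \<sigma> < 0 \<Longrightarrow> nome_symbol z \<tau> \<sigma> = 1 / nome_prod (z - \<sigma>) \<tau> (- \<sigma>)"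
  "Im \<tau> < 0 \<Longrightarrow> Im \<sigma> < 0 \<Longrightarrow> nome_symbol z \<tau> \<sigma> = nome_prod (z - (\<tau> + \<sigma>)) (- \<tau>) (- \<sigma>)"
proof -
  have [simp]: "\<not> Im \<tau> > 0" if "Im \<tau> < 0" for \<tau> using that by simp
  show "Im \<tau> > 0 \<Longrightarrow> Im \<sigma> > 0 \<Longrightarrow> nome_symbol z \<tau> \<sigma> = nome_prod z \<tau> \<sigma>"
    "Im \<tau> < 0 \<Longrightarrow> Im \<sigma> > 0 \<Longrightarrow> nome_symbol z \<tau> \<sigma> = 1 / nome_prod (z - \<tau>) (- \<tau>) \<sigma>"
    "Im \<tau> > 0 \<Longrightarrow> Im \<sigma> < 0 \<Longrightarrow> nome_symbol z \<tau> \<sigma> = 1 / nome_prod (z - \<sigma>) \<tau> (- \<sigma>)"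
    "Im \<tau> < 0 \<Longrightarrow> Im \<sigma> < 0 \<Longrightarrow> nome_symbol z \<tau> \<sigma> = nome_prod (z - (\<tau> + \<sigma>)) (- \<tau>) (- \<sigma>)"
    by (simp_all add: nome_symbol_def qr_symbol_def nome_prod_def nome_minus nome_diff nome_add)
qed

lemma nome_prod_rec:
  assumes "Im \<tau> > 0" "Im \<sigma> > 0"
  shows "nome_prod z \<tau> \<sigma> = qpoch (nome z) (nome \<sigma>) * nome_prod (z + \<tau>) \<tau> \<sigma>"
  using double_prod_rec[of "nome \<tau>" "nome \<sigma>" "nome z"] assms
  by (simp add: nome_prod_def nome_add mult_ac)

lemma nome_prod_commute:
  assumes "Im \<tau> > 0" "Im \<sigma> > 0"
  shows "nome_prod z \<tau> \<sigma> = nome_prod z \<sigma> \<tau>"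
  using assms by (simp add: nome_prod_def double_prod_commute)

lemma nome_prod_split:
  assumes "Im \<tau> > 0" "Im \<sigma> > 0"
  shows "nome_prod z \<tau> \<sigma> = nome_prod (z + \<tau>) \<tau> (\<tau> + \<sigma>) * nome_prod z (\<tau> + \<sigma>) \<sigma>"
  using double_prod_split[of "nome \<tau>" "nome \<sigma>" "nome z"] assms
  by (simp add: nome_prod_def nome_add mult_ac)

lemma nome_prod_nonzero:
  assumes "Im \<tau> > 0" "Im \<sigma> > 0" and z: "z \<notin> period_group \<tau> \<sigma>"
  shows "nome_prod z \<tau> \<sigma> \<noteq> 0"
proof
  assume "nome_prod z \<tau> \<sigma> = 0"
  then obtain j k where "nome z * nome \<tau> ^ j * nome \<sigma> ^ k = 1"
    using assms by (auto simp: nome_prod_def double_prod_eq_0_iff)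
  hence "nome (z + of_int (int j) * \<tau> + of_int (int k) * \<sigma>) = 1"
    by (simp add: nome_add nome_of_nat_mult)
  then obtain n where "z + of_int (int j) * \<tau> + of_int (int k) * \<sigma> = of_int n"
    unfolding nome_eq_1_iff by blast
  hence "z + of_int (int j) * \<tau> + of_int (int k) * \<sigma> \<in> period_group \<tau> \<sigma>"
    by (metis period_group_generators(1))
  thus False using z by (simp del: of_int_of_nat_eq)
qed

lemma nonreal_cases:
  assumes "\<tau> \<notin> \<real>" "\<sigma> \<notin> \<real>"
  obtains "Im \<tau> > 0" "Im \<sigma> > 0" | "Im \<tau> < 0" "Im \<sigma> > 0" | "Im \<tau> > 0" "Im \<sigma> < 0" | "Im \<tau> < 0" "Im \<sigma> < 0"
  using assms by (auto simp: not_Reals_iff_Im)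

lemma nome_symbol_commute:
  assumes "\<tau> \<notin> \<real>" "\<sigma> \<notin> \<real>"
  shows "nome_symbol z \<tau> \<sigma> = nome_symbol z \<sigma> \<tau>"
  using assms
  by (cases rule: nonreal_cases)
     (simp_all add: nome_symbol_eq nome_prod_commute[of \<tau> \<sigma>] nome_prod_commute[of \<tau> "-\<sigma>"]
        nome_prod_commute[of "-\<tau>" \<sigma>] nome_prod_commute[of "-\<tau>" "-\<sigma>"] add.commute[of \<tau> \<sigma>])

lemma nome_symbol_nonzero:
  assumes "\<tau> \<notin> \<real>" "\<sigma> \<notin> \<real>" "z \<notin> period_group \<tau> \<sigma>"
  shows "nome_symbol z \<tau> \<sigma> \<noteq> 0"
  using assms(1,2)
  by (cases rule: nonreal_cases) (use assms(3) in \<open>simp_all add: nome_symbol_eq nome_prod_nonzero\<close>)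

lemma nome_symbol_rec:
  assumes "\<tau> \<notin> \<real>" "\<sigma> \<notin> \<real>" and z: "z \<notin> period_group \<tau> \<sigma>"
  shows "nome_symbol z \<tau> \<sigma> = q_symbol (nome z) (nome \<sigma>) * nome_symbol (z + \<tau>) \<tau> \<sigma>"
proof -
  have qs: "q_symbol (nome z) (nome \<sigma>) =
      (if Im \<sigma> > 0 then qpoch (nome z) (nome \<sigma>) else 1 / qpoch (nome (z - \<sigma>)) (nome (- \<sigma>)))"
    by (simp add: q_symbol_def nome_minus nome_diff)
  from assms(1,2) show ?thesis
  proof (cases rule: nonreal_cases)
    case 1
    thus ?thesis by (simp add: nome_symbol_eq qs nome_prod_rec[of \<tau> \<sigma> z])
  next
    case 2
    have "nome_prod z (-\<tau>) \<sigma> = qpoch (nome z) (nome \<sigma>) * nome_prod (z - \<tau>) (-\<tau>) \<sigma>"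
      using nome_prod_rec[of "-\<tau>" \<sigma> z] 2 by simp
    moreover have "nome_prod z (-\<tau>) \<sigma> \<noteq> 0"
      using nome_prod_nonzero[of "-\<tau>" \<sigma> z] 2 z by simp
    ultimately show ?thesis using 2 by (simp add: nome_symbol_eq qs)
  next
    case 3
    have "nome_prod (z - \<sigma>) \<tau> (-\<sigma>) = qpoch (nome (z - \<sigma>)) (nome (-\<sigma>)) * nome_prod (z - \<sigma> + \<tau>) \<tau> (-\<sigma>)"
      using nome_prod_rec[of \<tau> "-\<sigma>" "z - \<sigma>"] 3 by simp
    thus ?thesis using 3 by (simp add: nome_symbol_eq qs algebra_simps)
  next
    case 4
    have "nome_prod (z - \<sigma>) (-\<tau>) (-\<sigma>) =
            qpoch (nome (z - \<sigma>)) (nome (-\<sigma>)) * nome_prod (z - (\<tau> + \<sigma>)) (-\<tau>) (-\<sigma>)"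
      using nome_prod_rec[of "-\<tau>" "-\<sigma>" "z - \<sigma>"] 4 by (simp add: algebra_simps)
    moreover have "nome_prod (z - \<sigma>) (-\<tau>) (-\<sigma>) \<noteq> 0"
      using nome_prod_nonzero[of "-\<tau>" "-\<sigma>" "z - \<sigma>"] 4 z by simp
    ultimately show ?thesis using 4 by (simp add: nome_symbol_eq qs)
  qed
qed

text \<open>
  In each of the six possible sign patterns of the imaginary parts of \<open>\<tau>\<close>, \<open>\<sigma>\<close> and \<open>\<tau> + \<sigma>\<close>, the claim
  is an instance of the splitting of a convergent double product, with the roles of the three
  factors permuted.
\<close>

lemma nome_symbol_split:
  assumes "\<tau> \<notin> \<real>" "\<sigma> \<notin> \<real>" "\<tau> + \<sigma> \<notin> \<real>" and z: "z \<notin> period_group \<tau> \<sigma>"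
  shows "nome_symbol z \<tau> \<sigma> = nome_symbol (z + \<tau>) \<tau> (\<tau> + \<sigma>) * nome_symbol z (\<tau> + \<sigma>) \<sigma>"
proof -
  have G: "period_group \<tau> (\<tau> + \<sigma>) = period_group \<tau> \<sigma>" "period_group (\<tau> + \<sigma>) \<sigma> = period_group \<tau> \<sigma>"
    using period_group_shear[of \<tau> \<sigma>] period_group_shear[of \<sigma> \<tau>]
    by (simp_all add: period_group_commute add.commute)
  have nz: "nome_prod w \<tau>' \<sigma>' \<noteq> 0" if "Im \<tau>' > 0" "Im \<sigma>' > 0" "period_group \<tau>' \<sigma>' = period_group \<tau> \<sigma>"
      "w \<notin> period_group \<tau> \<sigma>" for w \<tau>' \<sigma>'
    using nome_prod_nonzero[of \<tau>' \<sigma>' w] that by simp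
  define \<rho> where "\<rho> = \<tau> + \<sigma>"
  have \<rho>: "\<rho> \<notin> \<real>" using assms(3) by (simp add: \<rho>_def)
  have mem: "\<rho> \<in> period_group \<tau> \<sigma>" by (simp add: \<rho>_def)
  have G1: "period_group \<tau> \<rho> = period_group \<tau> \<sigma>"
    unfolding \<rho>_def by (rule period_group_shear)
  have G2: "period_group \<sigma> \<rho> = period_group \<tau> \<sigma>"
    unfolding \<rho>_def using period_group_shear[of \<sigma> \<tau>]
    by (simp only: add.commute[of \<sigma> \<tau>] period_group_commute[of \<sigma> \<tau>])
  have G: "period_group \<tau> \<rho> = period_group \<tau> \<sigma>" "period_group \<rho> \<sigma> = period_group \<tau> \<sigma>"
    "period_group \<rho> \<tau> = period_group \<tau> \<sigma>" "period_group \<sigma> \<rho> = period_group \<tau> \<sigma>"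
    "period_group \<sigma> \<tau> = period_group \<tau> \<sigma>"
    using G1 G2 period_group_commute by metis+
  have nz: "nome_prod w a b \<noteq> 0"
    if "Im a > 0" "Im b > 0" "period_group a b = period_group \<tau> \<sigma>" "w \<notin> period_group \<tau> \<sigma>" for w a b
    using nome_prod_nonzero[of a b w] that by simp
  have "nome_symbol z \<tau> \<sigma> = nome_symbol (z + \<tau>) \<tau> \<rho> * nome_symbol z \<rho> \<sigma>"
    using assms(1,2)
  proof (cases rule: nonreal_cases)
    case 1
    thus ?thesis using nome_prod_split[of \<tau> \<sigma> z] by (simp add: nome_symbol_eq \<rho>_def)
  next
    case 2
    show ?thesis
    proof (cases "Im \<rho> > 0")
      case True
      have "nome_prod z (-\<tau>) \<rho> = nome_prod (z - \<tau>) (-\<tau>) \<sigma> * nome_prod z \<sigma> \<rho>"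
        using nome_prod_split[of "-\<tau>" \<rho> z] 2 True by (simp add: \<rho>_def)
      moreover have "nome_prod z \<sigma> \<rho> \<noteq> 0" "nome_prod (z - \<tau>) (-\<tau>) \<sigma> \<noteq> 0"
        using 2 True z by (simp_all add: nz G)
      ultimately show ?thesis
        using 2 True by (simp add: nome_symbol_eq nome_prod_commute[of \<rho> \<sigma>])
    next
      case False
      hence neg: "Im \<rho> < 0" using \<rho> by (auto simp: not_Reals_iff_Im)
      have "nome_prod (z - \<rho>) \<sigma> (-\<rho>) = nome_prod (z - \<tau>) \<sigma> (-\<tau>) * nome_prod (z - \<rho>) (-\<tau>) (-\<rho>)"
        using nome_prod_split[of \<sigma> "-\<rho>" "z - \<rho>"] 2 neg by (simp add: \<rho>_def)
      moreover have "nome_prod (z - \<rho>) (-\<tau>) (-\<rho>) \<noteq> 0" "nome_prod (z - \<tau>) \<sigma> (-\<tau>) \<noteq> 0"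
        using 2 neg z mem by (simp_all add: nz G)
      ultimately show ?thesis
        using 2 neg by (simp add: nome_symbol_eq nome_prod_commute[of "-\<rho>" \<sigma>]
          nome_prod_commute[of "-\<tau>" \<sigma>])
    qed
  next
    case 3
    show ?thesis
    proof (cases "Im \<rho> > 0")
      case True
      have "nome_prod (z - \<sigma>) \<rho> (-\<sigma>) = nome_prod (z + \<tau>) \<rho> \<tau> * nome_prod (z - \<sigma>) \<tau> (-\<sigma>)"
        using nome_prod_split[of \<rho> "-\<sigma>" "z - \<sigma>"] 3 True by (simp add: \<rho>_def)
      moreover have "nome_prod (z + \<tau>) \<rho> \<tau> \<noteq> 0" "nome_prod (z - \<sigma>) \<tau> (-\<sigma>) \<noteq> 0"
        using 3 True z by (simp_all add: nz G)
      ultimately show ?thesis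
        using 3 True by (simp add: nome_symbol_eq nome_prod_commute[of \<rho> \<tau>])
    next
      case False
      hence neg: "Im \<rho> < 0" using \<rho> by (auto simp: not_Reals_iff_Im)
      have "nome_prod (z - \<sigma>) (-\<rho>) \<tau> = nome_prod (z - (\<rho> + \<sigma>)) (-\<rho>) (-\<sigma>) * nome_prod (z - \<sigma>) (-\<sigma>) \<tau>"
        using nome_prod_split[of "-\<rho>" \<tau> "z - \<sigma>"] 3 neg by (simp add: \<rho>_def algebra_simps)
      moreover have "nome_prod (z - (\<rho> + \<sigma>)) (-\<rho>) (-\<sigma>) \<noteq> 0" "nome_prod (z - \<sigma>) (-\<sigma>) \<tau> \<noteq> 0"
        using 3 neg z mem by (simp_all add: nz G)
      moreover have "nome_symbol (z + \<tau>) \<tau> \<rho> = 1 / nome_prod (z - \<sigma>) \<tau> (-\<rho>)"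
        using 3 neg by (simp add: nome_symbol_eq \<rho>_def)
      ultimately show ?thesis
        using 3 neg by (simp add: nome_symbol_eq nome_prod_commute[of "-\<rho>" \<tau>] nome_prod_commute[of "-\<sigma>" \<tau>])
    qed
  next
    case 4
    hence neg: "Im \<rho> < 0" by (simp add: \<rho>_def)
    have "nome_prod (z - \<rho>) (-\<sigma>) (-\<tau>) = nome_prod (z - (\<rho> + \<sigma>)) (-\<sigma>) (-\<rho>) * nome_prod (z - \<rho>) (-\<rho>) (-\<tau>)"
      using nome_prod_split[of "-\<sigma>" "-\<tau>" "z - \<rho>"] 4 by (simp add: \<rho>_def algebra_simps)
    moreover have "nome_symbol (z + \<tau>) \<tau> \<rho> = nome_prod (z - \<rho>) (-\<tau>) (-\<rho>)"
      using 4 neg by (simp add: nome_symbol_eq)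
    ultimately show ?thesis
      using 4 neg by (simp add: nome_symbol_eq nome_prod_commute[of "-\<sigma>" "-\<tau>"]
        nome_prod_commute[of "-\<sigma>" "-\<rho>"] nome_prod_commute[of "-\<rho>" "-\<tau>"] flip: \<rho>_def)
  qed
  thus ?thesis by (simp add: \<rho>_def)
qed

lemma tendsto_nome_prod:
  assumes "(f \<longlongrightarrow> z) F" "(g \<longlongrightarrow> \<tau>) F" "(h \<longlongrightarrow> \<sigma>) F" "Im \<tau> > 0" "Im \<sigma> > 0"
  shows "((\<lambda>t. nome_prod (f t) (g t) (h t)) \<longlongrightarrow> nome_prod z \<tau> \<sigma>) F"
  unfolding nome_prod_def using assms by (intro tendsto_intros) auto

lemma tendsto_nome_symbol:
  assumes f: "(f \<longlongrightarrow> z) F" and g: "(g \<longlongrightarrow> \<tau>) F" and h: "(h \<longlongrightarrow> \<sigma>) F"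
    and nonreal: "\<tau> \<notin> \<real>" "\<sigma> \<notin> \<real>" and z: "z \<notin> period_group \<tau> \<sigma>"
  shows "((\<lambda>t. nome_symbol (f t) (g t) (h t)) \<longlongrightarrow> nome_symbol z \<tau> \<sigma>) F"
proof -
  have ev_pos: "eventually (\<lambda>t. Im (u t) > 0) F" if "(u \<longlongrightarrow> w) F" "Im w > 0" for u :: "_ \<Rightarrow> complex" and w
    using order_tendstoD(1)[OF tendsto_Im[OF that(1)] that(2)] .
  have ev_neg: "eventually (\<lambda>t. Im (u t) < 0) F" if "(u \<longlongrightarrow> w) F" "Im w < 0" for u :: "_ \<Rightarrow> complex" and w
    using order_tendstoD(2)[OF tendsto_Im[OF that(1)] that(2)] .
  from nonreal show ?thesis
  proof (cases rule: nonreal_cases)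
    case 1
    have ev: "eventually (\<lambda>t. nome_prod (f t) (g t) (h t) = nome_symbol (f t) (g t) (h t)) F"
      using ev_pos[OF g 1(1)] ev_pos[OF h 1(2)] by eventually_elim (simp add: nome_symbol_eq)
    show ?thesis
      unfolding nome_symbol_eq(1)[OF 1]
      by (rule Lim_transform_eventually[OF _ ev]) (intro tendsto_nome_prod f g h 1)
  next
    case 2
    have ev: "eventually (\<lambda>t. 1 / nome_prod (f t - g t) (- g t) (h t) = nome_symbol (f t) (g t) (h t)) F"
      using ev_neg[OF g 2(1)] ev_pos[OF h 2(2)] by eventually_elim (simp add: nome_symbol_eq)
    have "nome_prod (z - \<tau>) (- \<tau>) \<sigma> \<noteq> 0"
      using 2 z by (simp add: nome_prod_nonzero)
    thus ?thesis
      unfolding nome_symbol_eq(2)[OF 2]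
      by (intro Lim_transform_eventually[OF _ ev] tendsto_intros tendsto_nome_prod f g h) (use 2 in auto)
  next
    case 3
    have ev: "eventually (\<lambda>t. 1 / nome_prod (f t - h t) (g t) (- h t) = nome_symbol (f t) (g t) (h t)) F"
      using ev_pos[OF g 3(1)] ev_neg[OF h 3(2)] by eventually_elim (simp add: nome_symbol_eq)
    have "nome_prod (z - \<sigma>) \<tau> (- \<sigma>) \<noteq> 0"
      using 3 z by (simp add: nome_prod_nonzero)
    thus ?thesis
      unfolding nome_symbol_eq(3)[OF 3]
      by (intro Lim_transform_eventually[OF _ ev] tendsto_intros tendsto_nome_prod f g h) (use 3 in auto)
  next
    case 4
    have ev: "eventually (\<lambda>t. nome_prod (f t - (g t + h t)) (- g t) (- h t) = nome_symbol (f t) (g t) (h t)) F"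
      using ev_neg[OF g 4(1)] ev_neg[OF h 4(2)] by eventually_elim (simp add: nome_symbol_eq)
    show ?thesis
      unfolding nome_symbol_eq(4)[OF 4]
      by (intro Lim_transform_eventually[OF _ ev] tendsto_intros tendsto_nome_prod f g h) (use 4 in auto)
  qed
qed

lemma holomorphic_nome_prod:
  assumes "f holomorphic_on A" "Im \<tau> > 0" "Im \<sigma> > 0"
  shows "(\<lambda>z. nome_prod (f z) \<tau> \<sigma>) holomorphic_on A"
  unfolding nome_prod_def using assms by (intro holomorphic_intros) auto

lemma nome_symbol_holomorphic_cases:
  assumes "\<tau> \<notin> \<real>" "\<sigma> \<notin> \<real>"
  shows "(\<lambda>z. nome_symbol z \<tau> \<sigma>) holomorphic_on UNIV \<or> (\<lambda>z. 1 / nome_symbol z \<tau> \<sigma>) holomorphic_on UNIV"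
  using assms
  by (cases rule: nonreal_cases) (auto simp: nome_symbol_eq intro!: holomorphic_nome_prod holomorphic_intros)

lemma meromorphic_nome_symbol:
  assumes "\<tau> \<notin> \<real>" "\<sigma> \<notin> \<real>" "f holomorphic_on UNIV"
  shows "(\<lambda>z. nome_symbol (f z) \<tau> \<sigma>) meromorphic_on UNIV"
  using nome_symbol_holomorphic_cases[OF assms(1,2)]
proof
  assume "(\<lambda>z. nome_symbol z \<tau> \<sigma>) holomorphic_on UNIV"
  from holomorphic_on_compose_gen[OF assms(3) this] have "(\<lambda>z. nome_symbol (f z) \<tau> \<sigma>) analytic_on UNIV"
    by (simp add: o_def analytic_on_open)
  thus ?thesis by (rule analytic_on_imp_meromorphic_on)
next
  assume "(\<lambda>z. 1 / nome_symbol z \<tau> \<sigma>) holomorphic_on UNIV"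
  from holomorphic_on_compose_gen[OF assms(3) this] have "(\<lambda>z. 1 / nome_symbol (f z) \<tau> \<sigma>) analytic_on UNIV"
    by (simp add: o_def analytic_on_open)
  hence "(\<lambda>z. inverse (1 / nome_symbol (f z) \<tau> \<sigma>)) meromorphic_on UNIV"
    by (intro meromorphic_intros analytic_on_imp_meromorphic_on)
  thus ?thesis by simp
qed

lemma analytic_nome_symbol:
  assumes "\<tau> \<notin> \<real>" "\<sigma> \<notin> \<real>" "f holomorphic_on UNIV" "f z \<notin> period_group \<tau> \<sigma>"
  shows "(\<lambda>z. nome_symbol (f z) \<tau> \<sigma>) analytic_on {z}"
  using nome_symbol_holomorphic_cases[OF assms(1,2)]
proof
  assume "(\<lambda>z. nome_symbol z \<tau> \<sigma>) holomorphic_on UNIV"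
  from holomorphic_on_compose_gen[OF assms(3) this] show ?thesis
    by (auto simp: o_def intro: holomorphic_on_imp_analytic_at)
next
  assume "(\<lambda>z. 1 / nome_symbol z \<tau> \<sigma>) holomorphic_on UNIV"
  from holomorphic_on_compose_gen[OF assms(3) this] have "(\<lambda>z. 1 / nome_symbol (f z) \<tau> \<sigma>) analytic_on {z}"
    by (auto simp: o_def intro: holomorphic_on_imp_analytic_at)
  hence "(\<lambda>z. inverse (1 / nome_symbol (f z) \<tau> \<sigma>)) analytic_on {z}"
    using nome_symbol_nonzero[OF assms(1,2,4)] by (intro analytic_on_inverse) auto
  thus ?thesis by simp
qed

section \<open>Functional equations of the elliptic gamma function\<close>

lemma elliptic_gamma_nonzero:
  assumes "\<tau> \<notin> \<real>" "\<sigma> \<notin> \<real>" "z \<notin> period_group \<tau> \<sigma>"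
  shows "elliptic_gamma z \<tau> \<sigma> \<noteq> 0"
  using assms by (simp add: elliptic_gamma_eq nome_symbol_nonzero)

lemma meromorphic_elliptic_gamma:
  assumes "\<tau> \<notin> \<real>" "\<sigma> \<notin> \<real>" "f holomorphic_on UNIV"
  shows "(\<lambda>z. elliptic_gamma (f z) \<tau> \<sigma>) meromorphic_on UNIV"
  unfolding elliptic_gamma_eq
  by (intro meromorphic_intros meromorphic_nome_symbol holomorphic_intros assms)

lemma analytic_elliptic_gamma:
  assumes "\<tau> \<notin> \<real>" "\<sigma> \<notin> \<real>" "f holomorphic_on UNIV" "f z \<notin> period_group \<tau> \<sigma>"
  shows "(\<lambda>z. elliptic_gamma (f z) \<tau> \<sigma>) analytic_on {z}"
  unfolding elliptic_gamma_eq
  by (intro analytic_intros analytic_nome_symbol holomorphic_intros assms)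
     (use assms in \<open>simp_all add: nome_symbol_nonzero\<close>)

lemma tendsto_elliptic_gamma:
  assumes "(f \<longlongrightarrow> z) F" "(g \<longlongrightarrow> \<tau>) F" "(h \<longlongrightarrow> \<sigma>) F"
    and "\<tau> \<notin> \<real>" "\<sigma> \<notin> \<real>" "z \<notin> period_group \<tau> \<sigma>"
  shows "((\<lambda>t. elliptic_gamma (f t) (g t) (h t)) \<longlongrightarrow> elliptic_gamma z \<tau> \<sigma>) F"
  unfolding elliptic_gamma_eq
  by (intro tendsto_intros tendsto_nome_symbol assms) (use assms in \<open>simp_all add: nome_symbol_nonzero\<close>)

lemma elliptic_gamma_commute:
  assumes "\<tau> \<notin> \<real>" "\<sigma> \<notin> \<real>"
  shows "elliptic_gamma z \<tau> \<sigma> = elliptic_gamma z \<sigma> \<tau>"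
  using assms by (simp add: elliptic_gamma_eq nome_symbol_commute[of \<tau> \<sigma>] add.commute[of \<tau> \<sigma>])

lemma elliptic_gamma_add_1: "elliptic_gamma (z + 1) \<tau> \<sigma> = elliptic_gamma z \<tau> \<sigma>"
  by (simp add: elliptic_gamma_eq nome_symbol_def nome_add nome_diff)

lemma elliptic_gamma_add_modulus:
  assumes "\<tau> \<notin> \<real>" "\<sigma> \<notin> \<real>" "z \<notin> period_group \<tau> \<sigma>"
  shows "elliptic_gamma (z + \<tau>) \<tau> \<sigma> = theta z \<sigma> * elliptic_gamma z \<tau> \<sigma>"
proof -
  have "nome_symbol (\<sigma> - z) \<tau> \<sigma> = q_symbol (nome (\<sigma> - z)) (nome \<sigma>) * nome_symbol (\<tau> + \<sigma> - z) \<tau> \<sigma>"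
    using nome_symbol_rec[of \<tau> \<sigma> "\<sigma> - z"] assms by (simp add: algebra_simps)
  moreover have "nome_symbol z \<tau> \<sigma> = q_symbol (nome z) (nome \<sigma>) * nome_symbol (z + \<tau>) \<tau> \<sigma>"
    using nome_symbol_rec assms by blast
  moreover have "nome_symbol z \<tau> \<sigma> \<noteq> 0"
    using assms by (simp add: nome_symbol_nonzero)
  ultimately show ?thesis
    by (auto simp: elliptic_gamma_eq theta_def field_simps)
qed

lemma elliptic_gamma_add_modulus':
  assumes "\<tau> \<notin> \<real>" "\<sigma> \<notin> \<real>" "z \<notin> period_group \<tau> \<sigma>"
  shows "elliptic_gamma (z + \<sigma>) \<tau> \<sigma> = theta z \<tau> * elliptic_gamma z \<tau> \<sigma>"
  using elliptic_gamma_add_modulus[of \<sigma> \<tau> z] elliptic_gamma_commute[of \<tau> \<sigma>] assms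
  by (simp add: period_group_commute)

text \<open>
  At these points \<open>q * r / x = x\<close>, so numerator and denominator of the gamma function coincide.
\<close>

lemma elliptic_gamma_center:
  assumes "\<tau> \<notin> \<real>" "\<sigma> \<notin> \<real>" "z \<notin> period_group \<tau> \<sigma>" and z: "2 * z = \<tau> + \<sigma> + of_int n"
  shows "elliptic_gamma z \<tau> \<sigma> = 1"
proof -
  have "\<tau> + \<sigma> - z = z - of_int n" using z by (simp add: algebra_simps)
  hence "nome_symbol (\<tau> + \<sigma> - z) \<tau> \<sigma> = nome_symbol z \<tau> \<sigma>"
    by (simp add: nome_symbol_def nome_diff)
  thus ?thesis using assms by (simp add: elliptic_gamma_eq nome_symbol_nonzero)
qed

lemma elliptic_gamma_modulus_sum:
  assumes "\<tau> \<notin> \<real>" "\<sigma> \<notin> \<real>" "\<tau> + \<sigma> \<notin> \<real>" and z: "z \<notin> period_group \<tau> \<sigma>"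
  shows "elliptic_gamma z (\<tau> + \<sigma>) \<sigma> = elliptic_gamma z \<tau> \<sigma> / elliptic_gamma (z + \<tau>) \<tau> (\<sigma> + \<tau>)"
proof -
  define y where "y = \<tau> + \<sigma> - z"
  have y: "y \<notin> period_group \<tau> \<sigma>" using z by (simp add: y_def)
  have Y: "nome_symbol y \<tau> \<sigma> = nome_symbol (y + \<sigma>) (\<tau> + \<sigma>) \<sigma> * nome_symbol y \<tau> (\<sigma> + \<tau>)"
    using nome_symbol_split[of \<sigma> \<tau> y] nome_symbol_commute[of "\<tau> + \<sigma>" \<sigma>] 
      nome_symbol_commute[of "\<tau> + \<sigma>" \<tau>] nome_symbol_commute[of \<tau> \<sigma>] assms y
    by (simp add: add.commute[of \<sigma> \<tau>] period_group_commute[of \<sigma>])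
  have Z: "nome_symbol z \<tau> \<sigma> = nome_symbol (z + \<tau>) \<tau> (\<sigma> + \<tau>) * nome_symbol z (\<tau> + \<sigma>) \<sigma>"
    using nome_symbol_split[of \<tau> \<sigma> z] assms by (simp add: add.commute)
  have nz: "nome_symbol y \<tau> \<sigma> \<noteq> 0" "nome_symbol z \<tau> \<sigma> \<noteq> 0"
    using assms y by (simp_all add: nome_symbol_nonzero)
  have e0: "elliptic_gamma z (\<tau> + \<sigma>) \<sigma> = nome_symbol (y + \<sigma>) (\<tau> + \<sigma>) \<sigma> / nome_symbol z (\<tau> + \<sigma>) \<sigma>"
    by (simp add: elliptic_gamma_eq y_def algebra_simps)
  have e1: "elliptic_gamma (z + \<tau>) \<tau> (\<sigma> + \<tau>) = nome_symbol y \<tau> (\<sigma> + \<tau>) / nome_symbol (z + \<tau>) \<tau> (\<sigma> + \<tau>)"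
    by (simp add: elliptic_gamma_eq y_def algebra_simps)
  have e2: "elliptic_gamma z \<tau> \<sigma> = nome_symbol y \<tau> \<sigma> / nome_symbol z \<tau> \<sigma>"
    by (simp add: elliptic_gamma_eq y_def)
  show ?thesis
    using nz unfolding e0 e1 e2 Y Z by (simp add: field_simps)
qed

section \<open>The modular relation\<close>

text \<open>
  The exceptional set may be dense: a meromorphic function that does not vanish identically near
  a point is nonzero on a punctured disc, and such a disc is uncountable.
\<close>

lemma meromorphic_eq_if_eq_off_countable:
  assumes f: "f meromorphic_on UNIV" and g: "g meromorphic_on UNIV" and X: "countable X"
    and eq: "\<And>z. z \<notin> X \<Longrightarrow> f z = g z"
  shows "meromorphic_eq f g"
proof -
  define h where "h = (\<lambda>z. f z - g z)"
  have h: "h meromorphic_on {w}" for w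
    unfolding h_def by (intro meromorphic_intros; rule meromorphic_on_subset) (use f g in auto)
  have "eventually (\<lambda>z. f z = g z) (at w)" for w
  proof (rule ccontr)
    assume "\<not> eventually (\<lambda>z. f z = g z) (at w)"
    hence "frequently (\<lambda>z. h z \<noteq> 0) (at w)"
      by (simp add: frequently_def h_def)
    hence "eventually (\<lambda>z. h z \<noteq> 0) (at w)"
      by (intro non_zero_neighbour meromorphic_on_isolated_singularity meromorphic_on_not_essential h)
    then obtain e where e: "e > 0" "\<And>z. z \<in> ball w e - {w} \<Longrightarrow> h z \<noteq> 0"
      by (auto simp: eventually_at dist_commute)
    have "ball w e \<subseteq> insert w X"
    proof
      fix x assume "x \<in> ball w e"
      thus "x \<in> insert w X"
        using e(2)[of x] eq[of x] by (cases "x = w"; cases "x \<in> X") (auto simp: h_def)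
    qed
    moreover have "countable (insert w X)" using X by simp
    ultimately show False
      using uncountable_ball[OF e(1), of w] countable_subset by blast
  qed
  thus ?thesis
    using f g by (simp add: meromorphic_eq_def eventually_cosparse_open_eq)
qed

lemma inverse_notin_Reals: "z \<notin> \<real> \<Longrightarrow> - 1 / z \<notin> \<real>" for z :: complex
  using Reals_minus[of "- 1 / z"] Reals_inverse[of "1 / z"] by (auto simp: inverse_eq_divide)

text \<open>
  The quotient of the two sides of the modular relation; the aim is to show that it equals one.
\<close>

definition modular_quotient :: "complex \<Rightarrow> complex \<Rightarrow> complex \<Rightarrow> complex" where
  "modular_quotient z \<tau> \<sigma> =
     exp (\<i> * of_real pi * Q_poly z \<tau> \<sigma>) * elliptic_gamma ((z - \<sigma>) / \<tau>) (- 1 / \<tau>) (- \<sigma> / \<tau>)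
       * elliptic_gamma z \<tau> \<sigma> / elliptic_gamma (z / \<sigma>) (\<tau> / \<sigma>) (- 1 / \<sigma>)"

text \<open>
  The parameters for which all three gamma functions in the modular relation are defined.
\<close>

locale modular_parameters =
  fixes \<tau> \<sigma> :: complex
  assumes nonreal: "\<tau> \<notin> \<real>" "\<sigma> \<notin> \<real>" "\<sigma> / \<tau> \<notin> \<real>"
begin

lemma nonzero: "\<tau> \<noteq> 0" "\<sigma> \<noteq> 0"
  using nonreal by auto

lemma nonreal_quotients:
  "- 1 / \<tau> \<notin> \<real>" "- 1 / \<sigma> \<notin> \<real>" "\<tau> / \<sigma> \<notin> \<real>" "- \<sigma> / \<tau> \<notin> \<real>"
proof -
  show "- 1 / \<tau> \<notin> \<real>"
    by (rule inverse_notin_Reals) (rule nonreal)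
  show "- 1 / \<sigma> \<notin> \<real>"
    by (rule inverse_notin_Reals) (rule nonreal)
  show "\<tau> / \<sigma> \<notin> \<real>"
    using inverse_notin_Reals[OF nonreal(3)] Reals_minus[of "\<tau> / \<sigma>"] by auto
  show "- \<sigma> / \<tau> \<notin> \<real>"
    using Reals_minus[of "- \<sigma> / \<tau>"] nonreal(3) by auto
qed

lemma scaled_notin_period_group:
  assumes "z \<notin> period_group \<tau> \<sigma>"
  shows "z / \<sigma> \<notin> period_group (\<tau> / \<sigma>) (- 1 / \<sigma>)"
    and "z / \<tau> \<notin> period_group (- 1 / \<tau>) (- \<sigma> / \<tau>)"
  using period_group_mult[of \<sigma> \<tau> \<sigma> "\<tau> / \<sigma>" "- 1 / \<sigma>" "z / \<sigma>"]
    period_group_mult[of \<tau> \<tau> \<sigma> "- 1 / \<tau>" "- \<sigma> / \<tau>" "z / \<tau>"] assms nonzero by auto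

lemma gammas_nonzero:
  assumes z: "z \<notin> period_group \<tau> \<sigma>"
  shows "elliptic_gamma (z / \<sigma>) (\<tau> / \<sigma>) (- 1 / \<sigma>) \<noteq> 0"
    and "elliptic_gamma ((z - \<sigma>) / \<tau>) (- 1 / \<tau>) (- \<sigma> / \<tau>) \<noteq> 0"
    and "elliptic_gamma z \<tau> \<sigma> \<noteq> 0"
proof -
  have z': "z - \<sigma> \<notin> period_group \<tau> \<sigma>" using z by simp
  show "elliptic_gamma (z / \<sigma>) (\<tau> / \<sigma>) (- 1 / \<sigma>) \<noteq> 0"
    by (rule elliptic_gamma_nonzero[OF nonreal_quotients(3,2) scaled_notin_period_group(1)[OF z]])
  show "elliptic_gamma ((z - \<sigma>) / \<tau>) (- 1 / \<tau>) (- \<sigma> / \<tau>) \<noteq> 0"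
    by (rule elliptic_gamma_nonzero[OF nonreal_quotients(1,4) scaled_notin_period_group(2)[OF z']])
  show "elliptic_gamma z \<tau> \<sigma> \<noteq> 0"
    by (rule elliptic_gamma_nonzero[OF nonreal(1,2) z])
qed

lemma Q_poly_add_sigma: "Q_poly (z + \<sigma>) \<tau> \<sigma> = Q_poly z \<tau> \<sigma> + theta_exponent z \<tau>"
  using nonzero by (simp add: Q_poly_def theta_exponent_def field_simps power2_eq_square power3_eq_cube)

lemma Q_poly_add_tau: "Q_poly (z + \<tau>) \<tau> \<sigma> = Q_poly z \<tau> \<sigma> + theta_exponent z \<sigma>"
  using nonzero by (simp add: Q_poly_def theta_exponent_def field_simps power2_eq_square power3_eq_cube)

lemma Q_poly_add_1:
  "Q_poly (z + 1) \<tau> \<sigma> =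
     Q_poly z \<tau> \<sigma> + theta_exponent ((z + 1) / \<sigma>) (\<tau> / \<sigma>) + (2 * (- ((z + 1) / \<tau>)) + 1)"
  using nonzero by (simp add: Q_poly_def theta_exponent_def field_simps power2_eq_square power3_eq_cube)

lemma Q_poly_center: "Q_poly ((\<tau> + \<sigma> - 1) / 2) \<tau> \<sigma> = 0"
  using nonzero by (simp add: Q_poly_def field_simps power2_eq_square power3_eq_cube)

text \<open>
  Under each generator of the group of periods, one gamma function is invariant and the other two
  change by theta factors that are related by the inversion formula. The cube root of unity in
  that formula disappears in the third power.
\<close>

lemma modular_quotient_add_sigma:
  assumes z: "z \<notin> period_group \<tau> \<sigma>"
  shows "modular_quotient (z + \<sigma>) \<tau> \<sigma> ^ 3 = modular_quotient z \<tau> \<sigma> ^ 3"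
proof -
  obtain c where c: "c ^ 3 = 1"
    "\<And>z. theta (z / \<tau>) (- 1 / \<tau>) = c * exp (\<i> * of_real pi * theta_exponent z \<tau>) * theta z \<tau>"
    using theta_modular[OF nonreal(1)] by blast
  have G: "elliptic_gamma (z + \<sigma>) \<tau> \<sigma> = theta z \<tau> * elliptic_gamma z \<tau> \<sigma>"
    by (rule elliptic_gamma_add_modulus'[OF nonreal(1,2) z])
  have L: "elliptic_gamma ((z + \<sigma>) / \<sigma>) (\<tau> / \<sigma>) (- 1 / \<sigma>) = elliptic_gamma (z / \<sigma>) (\<tau> / \<sigma>) (- 1 / \<sigma>)"
    using elliptic_gamma_add_1[of "z / \<sigma>"] nonzero by (simp add: add_divide_distrib)
  have A: "elliptic_gamma ((z - \<sigma>) / \<tau>) (- 1 / \<tau>) (- \<sigma> / \<tau>) =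
      theta (z / \<tau>) (- 1 / \<tau>) * elliptic_gamma ((z + \<sigma> - \<sigma>) / \<tau>) (- 1 / \<tau>) (- \<sigma> / \<tau>)"
    using elliptic_gamma_add_modulus'[OF nonreal_quotients(1,4) scaled_notin_period_group(2)[OF z]]
    by (simp add: diff_divide_distrib)
  have "modular_quotient z \<tau> \<sigma> = c * modular_quotient (z + \<sigma>) \<tau> \<sigma>"
    unfolding modular_quotient_def G L A c(2) Q_poly_add_sigma
    by (simp add: ring_distribs exp_add)
  thus ?thesis using c(1) by (simp add: power_mult_distrib)
qed

lemma modular_quotient_add_tau:
  assumes z: "z \<notin> period_group \<tau> \<sigma>"
  shows "modular_quotient (z + \<tau>) \<tau> \<sigma> ^ 3 = modular_quotient z \<tau> \<sigma> ^ 3"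
proof -
  obtain c where c: "c ^ 3 = 1"
    "\<And>z. theta (z / \<sigma>) (- 1 / \<sigma>) = c * exp (\<i> * of_real pi * theta_exponent z \<sigma>) * theta z \<sigma>"
    using theta_modular[OF nonreal(2)] by blast
  have G: "elliptic_gamma (z + \<tau>) \<tau> \<sigma> = theta z \<sigma> * elliptic_gamma z \<tau> \<sigma>"
    by (rule elliptic_gamma_add_modulus[OF nonreal(1,2) z])
  have L: "elliptic_gamma ((z + \<tau>) / \<sigma>) (\<tau> / \<sigma>) (- 1 / \<sigma>) =
      theta (z / \<sigma>) (- 1 / \<sigma>) * elliptic_gamma (z / \<sigma>) (\<tau> / \<sigma>) (- 1 / \<sigma>)"
    using elliptic_gamma_add_modulus[OF nonreal_quotients(3,2) scaled_notin_period_group(1)[OF z]]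
    by (simp add: add_divide_distrib)
  have A: "elliptic_gamma ((z + \<tau> - \<sigma>) / \<tau>) (- 1 / \<tau>) (- \<sigma> / \<tau>) =
      elliptic_gamma ((z - \<sigma>) / \<tau>) (- 1 / \<tau>) (- \<sigma> / \<tau>)"
    using elliptic_gamma_add_1[of "(z - \<sigma>) / \<tau>"] nonzero by (simp add: add_divide_distrib diff_divide_distrib algebra_simps)
  have "z + \<tau> \<notin> period_group \<tau> \<sigma>" using z by simp
  from gammas_nonzero(3)[OF this] have "theta z \<sigma> \<noteq> 0" unfolding G by auto
  hence "modular_quotient z \<tau> \<sigma> = c * modular_quotient (z + \<tau>) \<tau> \<sigma>"
    unfolding modular_quotient_def G L A c(2) Q_poly_add_tau
    using c(1) by (auto simp add: ring_distribs exp_add)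
  thus ?thesis using c(1) by (simp add: power_mult_distrib)
qed

lemma modular_quotient_add_1:
  assumes z: "z \<notin> period_group \<tau> \<sigma>"
  shows "modular_quotient (z + 1) \<tau> \<sigma> ^ 3 = modular_quotient z \<tau> \<sigma> ^ 3"
proof -
  define t where "t = \<tau> / \<sigma>"
  have t: "t \<notin> \<real>" "- 1 / t = - \<sigma> / \<tau>"
    using nonreal_quotients(3) by (simp_all add: t_def)
  have z1: "z + 1 \<notin> period_group \<tau> \<sigma>" "z + 1 - \<sigma> \<notin> period_group \<tau> \<sigma>" using z by simp_all
  obtain c where c: "c ^ 3 = 1"
    "\<And>z. theta (z / t) (- 1 / t) = c * exp (\<i> * of_real pi * theta_exponent z t) * theta z t"
    using theta_modular[OF t(1)] by blast
  have G: "elliptic_gamma (z + 1) \<tau> \<sigma> = elliptic_gamma z \<tau> \<sigma>"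
    by (rule elliptic_gamma_add_1)
  have L: "elliptic_gamma (z / \<sigma>) (\<tau> / \<sigma>) (- 1 / \<sigma>) =
      theta ((z + 1) / \<sigma>) t * elliptic_gamma ((z + 1) / \<sigma>) (\<tau> / \<sigma>) (- 1 / \<sigma>)"
    using elliptic_gamma_add_modulus'[OF nonreal_quotients(3,2) scaled_notin_period_group(1)[OF z1(1)]]
    by (simp add: add_divide_distrib t_def)
  have "elliptic_gamma ((z - \<sigma>) / \<tau>) (- 1 / \<tau>) (- \<sigma> / \<tau>) =
      theta ((z + 1 - \<sigma>) / \<tau>) (- \<sigma> / \<tau>) * elliptic_gamma ((z + 1 - \<sigma>) / \<tau>) (- 1 / \<tau>) (- \<sigma> / \<tau>)"
    using elliptic_gamma_add_modulus[OF nonreal_quotients(1,4) scaled_notin_period_group(2)[OF z1(2)]]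
    by (simp add: add_divide_distrib diff_divide_distrib)
  also have "theta ((z + 1 - \<sigma>) / \<tau>) (- \<sigma> / \<tau>) = theta ((z + 1) / \<tau> + - \<sigma> / \<tau>) (- \<sigma> / \<tau>)"
    by (simp add: diff_divide_distrib)
  also have "\<dots> = - nome (- ((z + 1) / \<tau>)) * theta ((z + 1) / \<tau>) (- \<sigma> / \<tau>)"
    by (subst theta_add_modulus[OF nonreal_quotients(4)]) (simp add: nome_minus)
  also have "(z + 1) / \<tau> = ((z + 1) / \<sigma>) / t"
    using nonzero by (simp add: t_def)
  also have "theta (((z + 1) / \<sigma>) / t) (- \<sigma> / \<tau>) =
      c * exp (\<i> * of_real pi * theta_exponent ((z + 1) / \<sigma>) t) * theta ((z + 1) / \<sigma>) t"
    by (rule c(2)[unfolded t(2)])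
  also have "- nome (- (((z + 1) / \<sigma>) / t)) = exp (\<i> * of_real pi * (2 * (- ((z + 1) / \<tau>)) + 1))"
    unfolding exp_pi_odd using nonzero by (simp add: t_def)
  finally have A: "elliptic_gamma ((z - \<sigma>) / \<tau>) (- 1 / \<tau>) (- \<sigma> / \<tau>) =
      exp (\<i> * of_real pi * (2 * (- ((z + 1) / \<tau>)) + 1)) *
      (c * exp (\<i> * of_real pi * theta_exponent ((z + 1) / \<sigma>) t) * theta ((z + 1) / \<sigma>) t) *
      elliptic_gamma ((z + 1 - \<sigma>) / \<tau>) (- 1 / \<tau>) (- \<sigma> / \<tau>)" .
  \<comment> \<open>It is a factor of a nonzero gamma value.\<close>
  have nz: "theta ((z + 1) / \<sigma>) t \<noteq> 0"
    using gammas_nonzero(1)[OF z] unfolding L by auto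
  have "exp (\<i> * of_real pi * Q_poly (z + 1) \<tau> \<sigma>) = exp (\<i> * of_real pi * Q_poly z \<tau> \<sigma>) *
     exp (\<i> * of_real pi * (2 * (- ((z + 1) / \<tau>)) + 1)) *
     exp (\<i> * of_real pi * theta_exponent ((z + 1) / \<sigma>) t)"
    unfolding Q_poly_add_1 t_def by (simp only: ring_distribs(1) exp_add mult_ac)
  hence "modular_quotient z \<tau> \<sigma> = c * modular_quotient (z + 1) \<tau> \<sigma>"
    unfolding modular_quotient_def G L A using nz by simp
  thus ?thesis using c(1) by (simp add: power_mult_distrib)
qed

lemma modular_quotient_add_period:
  assumes z: "z \<notin> period_group \<tau> \<sigma>" and w: "w \<in> period_group \<tau> \<sigma>"
  shows "modular_quotient (z + w) \<tau> \<sigma> ^ 3 = modular_quotient z \<tau> \<sigma> ^ 3"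
proof -
  obtain l m n :: int where w_eq: "w = of_int l * 1 + of_int m * \<tau> + of_int n * \<sigma>"
    using w by (auto simp: period_group_def)
  note per = periodic_on_of_int[of "- period_group \<tau> \<sigma>" "\<lambda>z. modular_quotient z \<tau> \<sigma> ^ 3"]
  have 1: "z + of_int l * 1 \<notin> period_group \<tau> \<sigma>"
    "modular_quotient (z + of_int l * 1) \<tau> \<sigma> ^ 3 = modular_quotient z \<tau> \<sigma> ^ 3"
    using per[of 1 z l] z modular_quotient_add_1 by auto
  have 2: "z + of_int l * 1 + of_int m * \<tau> \<notin> period_group \<tau> \<sigma>"
    "modular_quotient (z + of_int l * 1 + of_int m * \<tau>) \<tau> \<sigma> ^ 3 = modular_quotient (z + of_int l * 1) \<tau> \<sigma> ^ 3"
    using per[of \<tau> "z + of_int l * 1" m] 1(1) modular_quotient_add_tau by auto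
  have 3: "modular_quotient (z + of_int l * 1 + of_int m * \<tau> + of_int n * \<sigma>) \<tau> \<sigma> ^ 3 =
      modular_quotient (z + of_int l * 1 + of_int m * \<tau>) \<tau> \<sigma> ^ 3"
    using per[of \<sigma> "z + of_int l * 1 + of_int m * \<tau>" n] 2(1) modular_quotient_add_sigma by auto
  show ?thesis
    using 1 2 3 by (simp add: w_eq add.assoc)
qed

lemma analytic_modular_quotient:
  assumes z: "z \<notin> period_group \<tau> \<sigma>"
  shows "(\<lambda>z. modular_quotient z \<tau> \<sigma>) analytic_on {z}"
proof -
  have z': "z - \<sigma> \<notin> period_group \<tau> \<sigma>" using z by simp
  show ?thesis
    unfolding modular_quotient_def
  proof (intro analytic_intros)
    show "(\<lambda>z. Q_poly z \<tau> \<sigma>) analytic_on {z}"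
      unfolding Q_poly_def using nonzero by (intro analytic_intros) auto
    show "(\<lambda>z. elliptic_gamma ((z - \<sigma>) / \<tau>) (- 1 / \<tau>) (- \<sigma> / \<tau>)) analytic_on {z}"
      by (rule analytic_elliptic_gamma[OF nonreal_quotients(1,4)])
        (use nonzero scaled_notin_period_group(2)[OF z'] in \<open>auto intro!: holomorphic_intros\<close>)
    show "(\<lambda>z. elliptic_gamma z \<tau> \<sigma>) analytic_on {z}"
      by (rule analytic_elliptic_gamma[OF nonreal(1,2)]) (use z in auto)
    show "(\<lambda>z. elliptic_gamma (z / \<sigma>) (\<tau> / \<sigma>) (- 1 / \<sigma>)) analytic_on {z}"
      by (rule analytic_elliptic_gamma[OF nonreal_quotients(3,2)])
        (use nonzero scaled_notin_period_group(1)[OF z] in \<open>auto intro!: holomorphic_intros\<close>)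
  qed (use gammas_nonzero[OF z] in auto)
qed

text \<open>
  The point \<open>(\<tau> + \<sigma> - 1) / 2\<close> is a center of symmetry of all three gamma functions at once.
\<close>

lemma modular_quotient_center:
  assumes z: "(\<tau> + \<sigma> - 1) / 2 \<notin> period_group \<tau> \<sigma>"
  shows "modular_quotient ((\<tau> + \<sigma> - 1) / 2) \<tau> \<sigma> = 1"
proof -
  define z where "z = (\<tau> + \<sigma> - 1) / 2"
  have z: "z \<notin> period_group \<tau> \<sigma>" "z - \<sigma> \<notin> period_group \<tau> \<sigma>"
    using assms by (simp_all add: z_def)
  have "elliptic_gamma (z / \<sigma>) (\<tau> / \<sigma>) (- 1 / \<sigma>) = 1"
    by (rule elliptic_gamma_center[OF nonreal_quotients(3,2) scaled_notin_period_group(1)[OF z(1)], where n = 1])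
      (use nonzero in \<open>simp add: z_def field_simps\<close>)
  moreover have "elliptic_gamma ((z - \<sigma>) / \<tau>) (- 1 / \<tau>) (- \<sigma> / \<tau>) = 1"
    by (rule elliptic_gamma_center[OF nonreal_quotients(1,4) scaled_notin_period_group(2)[OF z(2)], where n = 1])
      (use nonzero in \<open>simp add: z_def field_simps\<close>)
  moreover have "elliptic_gamma z \<tau> \<sigma> = 1"
    by (rule elliptic_gamma_center[OF nonreal(1,2) z(1), where n = "-1"])
      (simp add: z_def field_simps)
  ultimately show ?thesis
    using Q_poly_center by (simp add: modular_quotient_def z_def)
qed

text \<open>
  If \<open>\<sigma>\<close> is rationally independent of \<open>1\<close> and \<open>\<tau>\<close>, the group of periods is not discrete:
  Dirichlet approximation applied to the two real coordinates of \<open>\<sigma>\<close> gives small elements.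
\<close>

lemma small_period:
  assumes indep: "\<And>l m n :: int. of_int l + of_int m * \<tau> + of_int n * \<sigma> = 0 \<Longrightarrow> n = 0"
    and e: "e > 0"
  obtains w where "w \<in> period_group \<tau> \<sigma>" "w \<noteq> 0" "norm w < e"
proof -
  obtain a b :: real where ab: "\<sigma> = of_real a + of_real b * \<tau>"
    using real_coordinates[OF nonreal(1)] .
  obtain N :: nat where N: "N > 0" "(1 + norm \<tau>) / e < N"
  proof -
    obtain N :: nat where N: "(1 + norm \<tau>) / e < N"
      using reals_Archimedean2 by blast
    moreover have "0 \<le> (1 + norm \<tau>) / e" using e by simp
    ultimately have "N > 0" by (metis le_less_trans of_nat_0_less_iff)
    thus ?thesis using N that by blast
  qed
  define \<theta> where "\<theta> = (\<lambda>i::nat. if i = 0 then a else b)"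
  obtain n p where n: "0 < n" and "\<And>i. i < 2 \<Longrightarrow> \<bar>of_int n * \<theta> i - of_int (p i)\<bar> < 1 / N"
    using Dirichlet_approx_simult[OF N(1), of 2 \<theta>] by metis
  from this(2)[of 0] this(2)[of 1]
  have p: "\<bar>of_int n * a - of_int (p 0)\<bar> < 1 / N" "\<bar>of_int n * b - of_int (p 1)\<bar> < 1 / N"
    by (simp_all add: \<theta>_def)
  define w where "w = of_int (- p 0) + of_int (- p 1) * \<tau> + of_int n * \<sigma>"
  show ?thesis
  proof
    show "w \<in> period_group \<tau> \<sigma>" unfolding w_def by blast
    show "w \<noteq> 0"
    proof
      assume "w = 0"
      hence "n = 0" unfolding w_def by (rule indep)
      thus False using n by simp
    qed
    have "w = of_real (of_int n * a - of_int (p 0)) + of_real (of_int n * b - of_int (p 1)) * \<tau>"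
      by (simp add: w_def ab algebra_simps)
    hence "norm w \<le> \<bar>of_int n * a - of_int (p 0)\<bar> + \<bar>of_int n * b - of_int (p 1)\<bar> * norm \<tau>"
      using norm_triangle_ineq[of "of_real (of_int n * a - of_int (p 0)) :: complex"
          "of_real (of_int n * b - of_int (p 1)) * \<tau>"]
      by (simp only: norm_mult norm_of_real)
    also have "\<dots> \<le> 1 / N + 1 / N * norm \<tau>"
      using p by (intro add_mono mult_right_mono) auto
    also have "\<dots> = (1 + norm \<tau>) / N" by (simp add: add_divide_distrib)
    also have "\<dots> < e" using N e by (simp add: field_simps)
    finally show "norm w < e" .
  qed
qed

lemma connected_compl_period_group: "connected (- period_group \<tau> \<sigma>)"
  by (intro path_connected_imp_connected path_connected_complement_countable countable_period_group) simp

text \<open>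
  For independent periods the cube of the quotient takes the same value at points accumulating
  at any given regular point, hence is locally constant. The complement of the
  countable group of periods is connected, so the cube is the constant one; by continuity the
  quotient itself is then constant, with the value one at the center.
\<close>

lemma modular_quotient_generic:
  assumes indep: "\<And>l m n :: int. of_int l + of_int m * \<tau> + of_int n * \<sigma> = 0 \<Longrightarrow> n = 0"
    and z: "z \<notin> period_group \<tau> \<sigma>"
  shows "modular_quotient z \<tau> \<sigma> = 1"
proof -
  define f where "f = (\<lambda>z. modular_quotient z \<tau> \<sigma>)"
  define S where "S = - period_group \<tau> \<sigma>"
  have conn: "connected S"
    unfolding S_def by (rule connected_compl_period_group)
  define z0 where "z0 = (\<tau> + \<sigma> - 1) / 2"
  have z0: "z0 \<in> S"
  proof -
    have "z0 \<notin> period_group \<tau> \<sigma>"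
    proof
      assume "z0 \<in> period_group \<tau> \<sigma>"
      then obtain l m n :: int where "z0 = of_int l + of_int m * \<tau> + of_int n * \<sigma>"
        by (auto simp: period_group_def)
      hence "of_int (2 * l + 1) + of_int (2 * m - 1) * \<tau> + of_int (2 * n - 1) * \<sigma> = 0"
        by (simp add: z0_def field_simps)
      from indep[OF this] show False by presburger
    qed
    thus ?thesis by (simp add: S_def)
  qed
  have fz0: "f z0 = 1"
    using modular_quotient_center z0 by (simp add: f_def z0_def S_def)
  have local: "\<exists>e>0. \<forall>x\<in>ball u e. f x ^ 3 = f u ^ 3" if u: "u \<in> S" for u
  proof -
    have u': "u \<notin> period_group \<tau> \<sigma>" using u by (simp add: S_def)
    from analytic_modular_quotient[OF this] obtain e where e: "e > 0" "f holomorphic_on ball u e"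
      unfolding f_def analytic_on_def by auto
    define U where "U = {u + w |w. w \<in> period_group \<tau> \<sigma>} \<inter> ball u e"
    have lim: "u islimpt U"
      unfolding islimpt_approachable
    proof (intro allI impI)
      fix d :: real assume d: "d > 0"
      obtain w where w: "w \<in> period_group \<tau> \<sigma>" "w \<noteq> 0" "norm w < min d e"
        using small_period[of "min d e"] indep d e by auto
      thus "\<exists>x'\<in>U. x' \<noteq> u \<and> dist x' u < d"
        by (intro bexI[of _ "u + w"]) (auto simp: U_def dist_norm)
    qed
    have "f x ^ 3 - f u ^ 3 = 0" if "x \<in> U" for x
      using that modular_quotient_add_period[OF u'] by (auto simp: U_def f_def)
    hence zero: "\<And>x. x \<in> U \<Longrightarrow> f x ^ 3 - f u ^ 3 = 0" by blast
    have "f x ^ 3 - f u ^ 3 = 0" if x: "x \<in> ball u e" for x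
    proof (rule analytic_continuation[of "\<lambda>x. f x ^ 3 - f u ^ 3" "ball u e" U u x])
      show "(\<lambda>x. f x ^ 3 - f u ^ 3) holomorphic_on ball u e"
        by (intro holomorphic_intros e)
      show "U \<subseteq> ball u e" unfolding U_def by (rule Int_lower2)
      show "u \<in> ball u e" using e(1) by simp
    qed (use lim zero x in \<open>fact | simp\<close>)+
    hence "\<forall>x\<in>ball u e. f x ^ 3 = f u ^ 3"
      unfolding right_minus_eq by blast
    thus ?thesis using e(1) by blast
  qed
  have cube: "f x ^ 3 = 1" if "x \<in> S" for x
  proof (rule connected_induction_simple[OF conn z0 that])
    show "f z0 ^ 3 = 1" by (simp add: fz0)
    fix u assume u: "u \<in> S"
    then obtain e where e: "e > 0" "\<forall>x\<in>ball u e. f x ^ 3 = f u ^ 3" using local by blast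
    show "\<exists>T. openin (top_of_set S) T \<and> u \<in> T \<and> (\<forall>x\<in>T. \<forall>y\<in>T. f x ^ 3 = 1 \<longrightarrow> f y ^ 3 = 1)"
    proof (intro exI[of _ "S \<inter> ball u e"] conjI ballI impI)
      show "f y ^ 3 = 1" if "x \<in> S \<inter> ball u e" "y \<in> S \<inter> ball u e" "f x ^ 3 = 1" for x y
        using e(2) that by (metis IntD2)
    qed (use e(1) u in \<open>simp_all add: openin_open_Int\<close>)
  qed
  have "f constant_on S"
  proof (rule continuous_finite_range_constant[OF conn])
    show "continuous_on S f"
      unfolding f_def S_def
      by (intro continuous_at_imp_continuous_on ballI analytic_at_imp_isCont analytic_modular_quotient) auto
    have "f ` S \<subseteq> {w. w ^ 3 = 1}" using cube by auto
    thus "finite (f ` S)" using finite_nth_roots[of 3 1] finite_subset by auto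
  qed
  hence "f z = f z0"
    using z z0 unfolding constant_on_def S_def by (metis ComplI)
  thus ?thesis using fz0 by (simp add: f_def)
qed

end

lemma tendsto_modular_quotient:
  assumes "modular_parameters \<tau> \<sigma>" "z \<notin> period_group \<tau> \<sigma>"
  shows "((\<lambda>s. modular_quotient z \<tau> s) \<longlongrightarrow> modular_quotient z \<tau> \<sigma>) (at \<sigma> within A)"
proof -
  interpret modular_parameters \<tau> \<sigma> by fact
  have z': "z - \<sigma> \<notin> period_group \<tau> \<sigma>" using assms by simp
  have id: "((\<lambda>s. s) \<longlongrightarrow> \<sigma>) (at \<sigma> within A)" by (rule tendsto_ident_at)
  have Q: "((\<lambda>s. Q_poly z \<tau> s) \<longlongrightarrow> Q_poly z \<tau> \<sigma>) (at \<sigma> within A)"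
    unfolding Q_poly_def using nonzero by (intro tendsto_intros id) auto
  show ?thesis
    unfolding modular_quotient_def
    by (intro tendsto_intros Q tendsto_elliptic_gamma id nonreal nonreal_quotients gammas_nonzero
          scaled_notin_period_group assms z' nonzero)
qed

text \<open>
  The restriction to independent periods is removed by continuity in \<open>\<sigma>\<close>.
\<close>

lemma elliptic_gamma_modular:
  assumes "\<tau> \<notin> \<real>" "\<sigma> \<notin> \<real>" "\<sigma> / \<tau> \<notin> \<real>" and z: "z \<notin> period_group \<tau> \<sigma>"
  shows "elliptic_gamma (z / \<sigma>) (\<tau> / \<sigma>) (- 1 / \<sigma>) =
           exp (\<i> * of_real pi * Q_poly z \<tau> \<sigma>) * elliptic_gamma ((z - \<sigma>) / \<tau>) (- 1 / \<tau>) (- \<sigma> / \<tau>)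
             * elliptic_gamma z \<tau> \<sigma>"
proof -
  interpret modular_parameters \<tau> \<sigma> using assms by unfold_locales
  \<comment> \<open>The values of \<open>\<sigma>\<close> for which \<open>z\<close> is a period, or \<open>1\<close>, \<open>\<tau>\<close>, \<open>\<sigma>\<close> are dependent, with the
      coefficient \<open>n\<close> of \<open>\<sigma>\<close> nonzero. For \<open>n = 0\<close> the division by zero adds the harmless value \<open>0\<close>.\<close>
  define X where "X = (\<Union>(l, m, n). {(z - of_int l - of_int m * \<tau>) / of_int n, (- of_int l - of_int m * \<tau>) / of_int n})"
  have "countable X" unfolding X_def by (intro countable_UN) auto
  have not_in_X: "z \<notin> period_group \<tau> s" "\<And>l m n :: int. of_int l + of_int m * \<tau> + of_int n * s = 0 \<Longrightarrow> n = 0"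
    if s: "s \<notin> X" for s
  proof -
    show "z \<notin> period_group \<tau> s"
    proof
      assume "z \<in> period_group \<tau> s"
      then obtain l m n :: int where lmn: "z = of_int l + of_int m * \<tau> + of_int n * s"
        by (auto simp: period_group_def)
      show False
      proof (cases "n = 0")
        case True
        hence "z = of_int l + of_int m * \<tau> + of_int 0 * \<sigma>" using lmn by simp
        thus False using z by blast
      next
        case False
        hence "s = (z - of_int l - of_int m * \<tau>) / of_int n" using lmn by (simp add: field_simps)
        thus False using s by (auto simp: X_def)
      qed
    qed
    fix l m n :: int assume lmn: "of_int l + of_int m * \<tau> + of_int n * s = 0"
    show "n = 0"
    proof (rule ccontr)
      assume "n \<noteq> 0"
      hence "s = (- of_int l - of_int m * \<tau>) / of_int n" 
        using lmn by (simp add: field_simps add_eq_0_iff)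
      thus False using s by (auto simp: X_def)
    qed
  qed
  have nontriv: "at \<sigma> within - X \<noteq> bot"
  proof -
    have "\<exists>x\<in>- X. x \<noteq> \<sigma> \<and> dist x \<sigma> < e" if "e > 0" for e
    proof (rule ccontr)
      assume "\<not> ?thesis"
      hence "ball \<sigma> e \<subseteq> insert \<sigma> X" by (auto simp: dist_commute)
      moreover have "countable (insert \<sigma> X)" using \<open>countable X\<close> by simp
      ultimately have "countable (ball \<sigma> e)" by (rule countable_subset)
      thus False using uncountable_ball[OF that, of \<sigma>] by contradiction
    qed
    thus ?thesis by (simp add: trivial_limit_within islimpt_approachable)
  qed
  have ev_nonreal: "eventually (\<lambda>s. g s \<notin> \<real>) (at \<sigma> within - X)"
    if "(g \<longlongrightarrow> g \<sigma>) (at \<sigma> within - X)" "g \<sigma> \<notin> \<real>" for g :: "complex \<Rightarrow> complex"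
    using topological_tendstoD[OF that(1), of "- \<real>"] that(2) closed_complex_Reals by (auto simp: open_Compl)
  have "eventually (\<lambda>s. s \<notin> X) (at \<sigma> within - X)"
    by (auto simp: eventually_at_filter)
  moreover have "eventually (\<lambda>s. s \<notin> \<real>) (at \<sigma> within - X)"
    using ev_nonreal[of "\<lambda>s. s"] nonreal by simp
  moreover have "eventually (\<lambda>s. s / \<tau> \<notin> \<real>) (at \<sigma> within - X)"
    using ev_nonreal[of "\<lambda>s. s / \<tau>"] nonreal nonzero by (simp add: tendsto_intros)
  ultimately have "eventually (\<lambda>s. 1 = modular_quotient z \<tau> s) (at \<sigma> within - X)"
  proof eventually_elim
    case (elim s)
    interpret s: modular_parameters \<tau> s using elim nonreal by unfold_locales auto
    show ?case using s.modular_quotient_generic not_in_X elim by metis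
  qed
  hence "((\<lambda>s. modular_quotient z \<tau> s) \<longlongrightarrow> 1) (at \<sigma> within - X)"
    by (rule Lim_transform_eventually[OF tendsto_const])
  moreover have "((\<lambda>s. modular_quotient z \<tau> s) \<longlongrightarrow> modular_quotient z \<tau> \<sigma>) (at \<sigma> within - X)"
    by (rule tendsto_modular_quotient[OF modular_parameters_axioms z])
  ultimately have "modular_quotient z \<tau> \<sigma> = 1"
    using nontriv tendsto_unique by blast
  thus ?thesis
    using gammas_nonzero(1)[OF z] by (simp add: modular_quotient_def)
qed

lemma meromorphic_eq_modular:
  assumes "\<tau> \<notin> \<real>" "\<sigma> \<notin> \<real>" "\<sigma> / \<tau> \<notin> \<real>"
  shows "meromorphic_eq (\<lambda>z. elliptic_gamma (z / \<sigma>) (\<tau> / \<sigma>) (- 1 / \<sigma>))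
        (\<lambda>z. exp (\<i> * of_real pi * Q_poly z \<tau> \<sigma>)
              * elliptic_gamma ((z - \<sigma>) / \<tau>) (- 1 / \<tau>) (- \<sigma> / \<tau>)
              * elliptic_gamma z \<tau> \<sigma>)"
proof (rule meromorphic_eq_if_eq_off_countable[OF _ _ countable_period_group[of \<tau> \<sigma>]])
  interpret modular_parameters \<tau> \<sigma> using assms by unfold_locales
  show "(\<lambda>z. elliptic_gamma (z / \<sigma>) (\<tau> / \<sigma>) (- 1 / \<sigma>)) meromorphic_on UNIV"
    using nonzero by (intro meromorphic_elliptic_gamma nonreal_quotients holomorphic_intros)
  have "(\<lambda>z. exp (\<i> * of_real pi * Q_poly z \<tau> \<sigma>)) holomorphic_on UNIV"
    unfolding Q_poly_def using nonzero by (intro holomorphic_intros) auto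
  hence "(\<lambda>z. exp (\<i> * of_real pi * Q_poly z \<tau> \<sigma>)) meromorphic_on UNIV"
    by (simp add: analytic_on_imp_meromorphic_on analytic_on_open)
  thus "(\<lambda>z. exp (\<i> * of_real pi * Q_poly z \<tau> \<sigma>)
              * elliptic_gamma ((z - \<sigma>) / \<tau>) (- 1 / \<tau>) (- \<sigma> / \<tau>)
              * elliptic_gamma z \<tau> \<sigma>) meromorphic_on UNIV"
    using nonzero by (intro meromorphic_on_mult meromorphic_elliptic_gamma nonreal nonreal_quotients holomorphic_intros)
qed (rule elliptic_gamma_modular[OF assms])

section \<open>The identities of meromorphic functions\<close>

theorem theorem4p1:
  fixes \<tau> \<sigma> :: complex
  assumes "\<tau> \<notin> \<real>" and "\<sigma> \<notin> \<real>" and "\<sigma> / \<tau> \<notin> \<real>" and "\<tau> + \<sigma> \<notin> \<real>"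
  shows "meromorphic_eq (\<lambda>z. elliptic_gamma z (\<tau> + 1) \<sigma>) (\<lambda>z. elliptic_gamma z \<tau> (\<sigma> + 1))
    \<and> meromorphic_eq (\<lambda>z. elliptic_gamma z \<tau> (\<sigma> + 1)) (\<lambda>z. elliptic_gamma z \<tau> \<sigma>)
    \<and> meromorphic_eq (\<lambda>z. elliptic_gamma z (\<tau> + \<sigma>) \<sigma>)
        (\<lambda>z. elliptic_gamma z \<tau> \<sigma> / elliptic_gamma (z + \<tau>) \<tau> (\<sigma> + \<tau>))
    \<and> meromorphic_eq (\<lambda>z. elliptic_gamma (z / \<sigma>) (\<tau> / \<sigma>) (- 1 / \<sigma>))
        (\<lambda>z. exp (\<i> * of_real pi * Q_poly z \<tau> \<sigma>)
              * elliptic_gamma ((z - \<sigma>) / \<tau>) (- 1 / \<tau>) (- \<sigma> / \<tau>)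
              * elliptic_gamma z \<tau> \<sigma>)
    \<and> meromorphic_eq (\<lambda>z. elliptic_gamma (z / \<tau>) (- 1 / \<tau>) (\<sigma> / \<tau>))
        (\<lambda>z. exp (\<i> * of_real pi * Q_poly z \<tau> \<sigma>)
              * elliptic_gamma ((z - \<tau>) / \<sigma>) (- \<tau> / \<sigma>) (- 1 / \<sigma>)
              * elliptic_gamma z \<tau> \<sigma>)"
proof (intro conjI)
  have mero: "(\<lambda>z. elliptic_gamma z \<tau> \<sigma>) meromorphic_on UNIV"
    by (intro meromorphic_elliptic_gamma assms holomorphic_intros)
  have refl: "meromorphic_eq (\<lambda>z. elliptic_gamma z \<tau> \<sigma>) (\<lambda>z. elliptic_gamma z \<tau> \<sigma>)"
    using mero by (simp add: meromorphic_eq_def)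
  have shift: "elliptic_gamma z (\<tau> + 1) \<sigma> = elliptic_gamma z \<tau> \<sigma>"
    "elliptic_gamma z \<tau> (\<sigma> + 1) = elliptic_gamma z \<tau> \<sigma>" for z
    by (simp_all add: elliptic_gamma_def ring_distribs exp_add)
  show "meromorphic_eq (\<lambda>z. elliptic_gamma z (\<tau> + 1) \<sigma>) (\<lambda>z. elliptic_gamma z \<tau> (\<sigma> + 1))"
    "meromorphic_eq (\<lambda>z. elliptic_gamma z \<tau> (\<sigma> + 1)) (\<lambda>z. elliptic_gamma z \<tau> \<sigma>)"
    unfolding shift by (rule refl)+
  show "meromorphic_eq (\<lambda>z. elliptic_gamma z (\<tau> + \<sigma>) \<sigma>)
        (\<lambda>z. elliptic_gamma z \<tau> \<sigma> / elliptic_gamma (z + \<tau>) \<tau> (\<sigma> + \<tau>))"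
  proof (rule meromorphic_eq_if_eq_off_countable[OF _ _ countable_period_group[of \<tau> \<sigma>]])
    show "(\<lambda>z. elliptic_gamma z (\<tau> + \<sigma>) \<sigma>) meromorphic_on UNIV"
      by (intro meromorphic_elliptic_gamma assms holomorphic_intros)
    show "(\<lambda>z. elliptic_gamma z \<tau> \<sigma> / elliptic_gamma (z + \<tau>) \<tau> (\<sigma> + \<tau>)) meromorphic_on UNIV"
      using assms(4) by (intro meromorphic_on_divide meromorphic_elliptic_gamma assms holomorphic_intros)
        (simp_all add: add.commute)
  qed (rule elliptic_gamma_modulus_sum[OF assms(1,2,4)])
  show "meromorphic_eq (\<lambda>z. elliptic_gamma (z / \<sigma>) (\<tau> / \<sigma>) (- 1 / \<sigma>))
        (\<lambda>z. exp (\<i> * of_real pi * Q_poly z \<tau> \<sigma>)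
              * elliptic_gamma ((z - \<sigma>) / \<tau>) (- 1 / \<tau>) (- \<sigma> / \<tau>)
              * elliptic_gamma z \<tau> \<sigma>)"
    by (rule meromorphic_eq_modular[OF assms(1-3)])
  interpret modular_parameters \<tau> \<sigma> using assms by unfold_locales
  \<comment> \<open>The last relation is the previous one with \<open>\<tau>\<close> and \<open>\<sigma>\<close> interchanged.\<close>
  interpret swap: modular_parameters \<sigma> \<tau>
    using assms nonreal_quotients by unfold_locales
  have "Q_poly z \<sigma> \<tau> = Q_poly z \<tau> \<sigma>" for z
    by (simp add: Q_poly_def algebra_simps)
  thus "meromorphic_eq (\<lambda>z. elliptic_gamma (z / \<tau>) (- 1 / \<tau>) (\<sigma> / \<tau>))
        (\<lambda>z. exp (\<i> * of_real pi * Q_poly z \<tau> \<sigma>)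
              * elliptic_gamma ((z - \<tau>) / \<sigma>) (- \<tau> / \<sigma>) (- 1 / \<sigma>)
              * elliptic_gamma z \<tau> \<sigma>)"
    using meromorphic_eq_modular[OF swap.nonreal]
      elliptic_gamma_commute[OF nonreal_quotients(1) nonreal(3)]
      elliptic_gamma_commute[OF swap.nonreal_quotients(4) nonreal_quotients(2)]
      elliptic_gamma_commute[OF nonreal(1,2)] by simp
qed

end
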